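(* For every positive integer $t$ and every graph $G\in \mathcal{B}_t$, we have $\chi(G)\leq \omega(G)^{4\log_2 t+13}$.
   Context: All graphs are finite, with no loops and no parallel edges. $\chi(G)$ and $\omega(G)$ denote the chromatic number and the clique number of $G$. A bull is the five-vertex graph obtained from a four-vertex path by adding one new vertex adjacent to exactly the two middle vertices of the path. A graph $G$ is bull-free if no induced subgraph of $G$ is (isomorphic to) a bull. For a positive integer $t$, $\mathcal{B}_t$ denotes the class of all bull-free graphs $G$ such that every triangle-free induced subgraph of $G$ has chromatic number at most $t$. *)

theory Defs
  imports Complex_Main "Graph_Theory.Graph_Theory"
begin

text \<open>
  A finite graph without loops and parallel edges is an instance of the locale \<^locale>\<open>graph\<close>:
  every undirected edge is represented by its two opposite arcs, so that \<open>u \<rightarrow>\<^bsub>G\<^esub> v\<close> is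
  adjacency. The null graph is allowed; both its chromatic and its clique number are \<open>0\<close>.
\<close>

definition proper_colouring :: "('a, 'b) pre_digraph \<Rightarrow> nat \<Rightarrow> ('a \<Rightarrow> nat) \<Rightarrow> bool" where
  "proper_colouring G k c \<longleftrightarrow>
     c ` verts G \<subseteq> {..<k} \<and> (\<forall>u v. u \<rightarrow>\<^bsub>G\<^esub> v \<longrightarrow> c u \<noteq> c v)"

definition chromatic_number :: "('a, 'b) pre_digraph \<Rightarrow> nat" where
  "chromatic_number G = (LEAST k. \<exists>c. proper_colouring G k c)"

definition clique :: "('a, 'b) pre_digraph \<Rightarrow> 'a set \<Rightarrow> bool" where
  "clique G K \<longleftrightarrow> K \<subseteq> verts G \<and> pairwise (\<lambda>u v. u \<rightarrow>\<^bsub>G\<^esub> v) K"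

definition clique_number :: "('a, 'b) pre_digraph \<Rightarrow> nat" where
  "clique_number G = Max (card ` {K. clique G K})"

text \<open>The path \<open>0 - 1 - 2 - 3\<close> together with a vertex \<open>4\<close> adjacent to exactly \<open>1\<close> and \<open>2\<close>.\<close>

definition bull :: "nat pair_pre_digraph" where
  "bull = \<lparr> pverts = {0, 1, 2, 3, 4},
            parcs = symcl {(0, 1), (1, 2), (2, 3), (4, 1), (4, 2)} \<rparr>"

definition bull_free :: "('a, 'b) pre_digraph \<Rightarrow> bool" where
  "bull_free G \<longleftrightarrow> \<not> (\<exists>H. induced_subgraph H G \<and> digraph_iso H (with_proj bull))"

definition triangle_free :: "('a, 'b) pre_digraph \<Rightarrow> bool" where
  "triangle_free G \<longleftrightarrow> \<not> (\<exists>H. induced_subgraph H G \<and> K\<^bsub>3\<^esub> H)"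

definition bull_free_class :: "nat \<Rightarrow> ('a, 'b) pre_digraph set" (\<open>\<B>\<^bsub>_\<^esub>\<close>) where
  "\<B>\<^bsub>t\<^esub> = {G. graph G \<and> bull_free G \<and>
     (\<forall>H. induced_subgraph H G \<and> triangle_free H \<longrightarrow> chromatic_number H \<le> t)}"

end

theory Submission
  imports Defs
begin

text \<open>
  Call a set of vertices indecomposable if it has at least two elements and only trivial homogeneous
  subsets. Every graph arises by substituting graphs for the vertices of an indecomposable one.

  Let \<open>R\<close> be indecomposable and bull-free, \<open>v \<in> R\<close>, and let \<open>P\<close> be an indecomposable set of
  non-neighbours of \<open>v\<close> with at least three elements. As \<open>P\<close> is not homogeneous in \<open>R\<close>, bull-freeness
  provides a vertex \<open>p\<close> mixed on \<open>P\<close> with a neighbour \<open>g\<close> anticomplete to \<open>P\<close>, and then the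
  neighbourhood of \<open>p\<close> in \<open>P\<close> is stable. Consider the distance levels of \<open>{g, p} \<union> P\<close> from \<open>g\<close>. An
  indecomposable subset of a level is triangle-free or has a complete vertex; in the latter case it
  also has the anticomplete vertex \<open>v\<close>, and it is a split graph because a bull-free \<open>R\<close> then
  contains a vertex \<open>r\<close> whose neighbours in it are stable and whose non-neighbours in it form a clique.

  Polynomial bounds survive substitution with a loss in the degree: at most one of two adjacent parts
  has more than half the clique number, and the parts of small clique number get colours from the top
  of the palette. Applied to the levels this bounds \<open>\<chi>(P)\<close> by \<open>2 \<omega>(P)\<^sup>L\<^sup>+\<^sup>5\<close> where \<open>t \<le> 2\<^sup>L\<close>;
  applied once more it bounds the non-neighbourhoods. Since every maximum clique of \<open>R\<close>
  contains \<open>v\<close> or a non-neighbour of \<open>v\<close>, every bull-free graph splits into a set bounded in this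
  way and a set of smaller clique number, which costs one further factor \<open>\<omega>\<close>.
\<close>

lemma card2_distinct:
  assumes "finite Y" "2 \<le> card Y"
  obtains x y where "x \<in> Y" "y \<in> Y" "x \<noteq> y"
  using assms card_le_Suc0_iff_eq[of Y] by fastforce

subsection \<open>Arithmetic of the palettes\<close>

text \<open>The top \<open>palette_offset b c a n k\<close> of the \<open>n ^ a\<close> colours are reserved for the parts of
  clique number at most \<open>n div 2 ^ k\<close>.\<close>

definition palette_offset :: "nat \<Rightarrow> nat \<Rightarrow> nat \<Rightarrow> nat \<Rightarrow> nat \<Rightarrow> nat" where
  "palette_offset b c a n k = (\<Sum>j\<in>{k..n}. 2 ^ c * (2 ^ (j + 1)) ^ b * (n div 2 ^ j) ^ a)"

text \<open>Since \<open>(n div 2 ^ j) ^ a\<close> is at most \<open>n ^ a / 2 ^ (j * a)\<close>,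
  only exponents of two have to be compared. The bound on \<open>a\<close> is what
  \<open>j = 1\<close> demands; for larger \<open>j\<close> the side with \<open>a\<close> grows
  faster.\<close>

lemma palette_term:
  fixes a b c n j :: nat
  assumes a: "2 * b + c + 3 \<le> a" and "1 \<le> j"
  shows "2 ^ c * (2 ^ (j + 1)) ^ b * (n div 2 ^ j) ^ a * 2 ^ (j + 2) \<le> n ^ a"
proof -
  have "c + (j + 1) * b + (j + 2) \<le> j * (2 * b + c + 3)"
  proof -
    have "c \<le> j * c" "b \<le> j * b" "3 \<le> j * 3" using \<open>1 \<le> j\<close> by auto
    moreover have "c + (j + 1) * b + (j + 2) = c + b + j * b + j + 2"
      "j * (2 * b + c + 3) = 2 * (j * b) + j * c + j * 3"
      by (simp_all add: algebra_simps)
    ultimately show ?thesis using \<open>1 \<le> j\<close> by linarith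
  qed
  also have "\<dots> \<le> j * a" using a by (rule mult_le_mono2)
  finally have "(2::nat) ^ (c + (j + 1) * b + (j + 2)) \<le> 2 ^ (j * a)"
    by (rule power_increasing) simp
  then have "2 ^ (c + (j + 1) * b + (j + 2)) * (n div 2 ^ j) ^ a \<le> 2 ^ (j * a) * (n div 2 ^ j) ^ a"
    by (rule mult_le_mono1)
  also have "\<dots> = (n div 2 ^ j * 2 ^ j) ^ a"
    unfolding power_mult power_mult_distrib by (rule mult.commute)
  also have "\<dots> \<le> n ^ a" by (intro power_mono) auto
  finally show ?thesis unfolding power_mult[symmetric] by (simp only: power_add mult_ac)
qed

lemma geometric_tail:
  "(\<Sum>j\<in>{k..m}. 1 / 2 ^ (j + 2)) \<le> (1 / 2 ^ (k + 1) :: real)"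
proof (cases "k \<le> m")
  case True
  then have "(\<Sum>j\<in>{k..m}. 1 / 2 ^ (j + 2)) = (1 / 2 ^ (k + 1) - 1 / 2 ^ (m + 2) :: real)"
  proof (induction m rule: dec_induct)
    case (step n)
    have "(\<Sum>j\<in>{k..Suc n}. 1 / 2 ^ (j + 2)) = (\<Sum>j\<in>{k..n}. 1 / 2 ^ (j + 2)) + (1 / 2 ^ (Suc n + 2) :: real)"
      using step.hyps by (simp add: sum.cl_ivl_Suc)
    then show ?case unfolding step.IH by (simp add: field_simps)
  qed (simp add: field_simps)
  then show ?thesis by simp
qed simp

text \<open>A part of clique number \<open>w\<close> on level \<open>k\<close> leaves at most
  \<open>n - w\<close> to an adjacent part. One factor \<open>n - w\<close> already saves
  \<open>n ^ a / 2 ^ (k + 1)\<close> colours, and by the geometric tail this saving pays for the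
  whole offset.\<close>

lemma palette_bound:
  fixes a b c n k w :: nat
  assumes a: "2 * b + c + 3 \<le> a" and "1 \<le> k" and w: "n \<le> 2 ^ (k + 1) * w" "w \<le> n"
  shows "(n - w) ^ a + palette_offset b c a n k \<le> n ^ a"
proof -
  have "real (palette_offset b c a n k)
      = (\<Sum>j\<in>{k..n}. real (2 ^ c * (2 ^ (j + 1)) ^ b * (n div 2 ^ j) ^ a))"
    unfolding palette_offset_def by (rule of_nat_sum)
  also have "\<dots> \<le> (\<Sum>j\<in>{k..n}. real (n ^ a) * (1 / 2 ^ (j + 2)))"
  proof (rule sum_mono)
    fix j assume "j \<in> {k..n}"
    then have "2 ^ c * (2 ^ (j + 1)) ^ b * (n div 2 ^ j) ^ a * 2 ^ (j + 2) \<le> n ^ a"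
      using palette_term[OF a] \<open>1 \<le> k\<close> by simp
    then have "real (2 ^ c * (2 ^ (j + 1)) ^ b * (n div 2 ^ j) ^ a * 2 ^ (j + 2)) \<le> real (n ^ a)"
      by (rule of_nat_mono)
    then have "real (2 ^ c * (2 ^ (j + 1)) ^ b * (n div 2 ^ j) ^ a) * 2 ^ (j + 2) \<le> real (n ^ a)"
      by (simp add: algebra_simps)
    then show "real (2 ^ c * (2 ^ (j + 1)) ^ b * (n div 2 ^ j) ^ a) \<le> real (n ^ a) * (1 / 2 ^ (j + 2))"
      by (simp add: pos_le_divide_eq del: power_add power_Suc of_nat_mult of_nat_power)
  qed
  also have "\<dots> = real (n ^ a) * (\<Sum>j\<in>{k..n}. 1 / 2 ^ (j + 2))"
    by (rule sum_distrib_left[symmetric])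
  also have "\<dots> \<le> real (n ^ a) * (1 / 2 ^ (k + 1))"
    by (intro mult_left_mono geometric_tail) auto
  finally have 1: "real (palette_offset b c a n k) \<le> real n ^ a / 2 ^ (k + 1)" by simp
  obtain a' where a': "a = Suc a'" using a by (cases a) auto
  have "real n \<le> 2 ^ (k + 1) * real w"
    using of_nat_mono[OF w(1), where 'a = real] by simp
  then have 2: "real n / 2 ^ (k + 1) \<le> real w" by (simp add: pos_divide_le_eq mult.commute)
  have "real ((n - w) ^ a) = (real n - real w) ^ a' * (real n - real w)"
    using w(2) a' by (simp add: of_nat_diff)
  also have "\<dots> \<le> real n ^ a' * (real n - real w)"
    using w(2) by (intro mult_right_mono power_mono) auto
  also have "\<dots> \<le> real n ^ a' * (real n - real n / 2 ^ (k + 1))"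
    using 2 by (intro mult_left_mono) auto
  also have "\<dots> = real n ^ a - real n ^ a / 2 ^ (k + 1)" using a' by (simp add: algebra_simps)
  finally have "real ((n - w) ^ a + palette_offset b c a n k) \<le> real (n ^ a)" using 1 by simp
  then show ?thesis by (simp only: of_nat_le_iff)
qed

lemma palette_offset_antimono: "k \<le> l \<Longrightarrow> palette_offset b c a n l \<le> palette_offset b c a n k"
  unfolding palette_offset_def by (rule sum_mono2) auto

lemma palette_offset_step:
  "k \<le> n \<Longrightarrow> palette_offset b c a n k
     = 2 ^ c * (2 ^ (k + 1)) ^ b * (n div 2 ^ k) ^ a + palette_offset b c a n (k + 1)"
  unfolding palette_offset_def by (simp add: sum.atLeast_Suc_atMost)

subsection \<open>Homogeneous sets in bull-free graphs\<close>

locale adjacency =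
  fixes E :: "'a \<Rightarrow> 'a \<Rightarrow> bool"
  assumes sym: "E x y \<Longrightarrow> E y x"
    and irrefl: "\<not> E x x"
begin

definition homogeneous :: "'a set \<Rightarrow> 'a set \<Rightarrow> bool" where
  "homogeneous X Y \<longleftrightarrow> X \<subseteq> Y \<and> (\<forall>u\<in>Y - X. (\<forall>x\<in>X. E u x) \<or> (\<forall>x\<in>X. \<not> E u x))"

definition indecomposable :: "'a set \<Rightarrow> bool" where
  "indecomposable Y \<longleftrightarrow>
     finite Y \<and> 2 \<le> card Y \<and> (\<forall>X. homogeneous X Y \<longrightarrow> card X \<le> 1 \<or> X = Y)"

text \<open>Connectivity through cuts instead of paths: a mixed vertex defines a cut, and the
  crossing edge becomes part of a bull.\<close>

definition connected_set :: "'a set \<Rightarrow> bool" where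
  "connected_set K \<longleftrightarrow> (\<forall>X. X \<subseteq> K \<longrightarrow> X \<noteq> {} \<longrightarrow> X \<noteq> K \<longrightarrow> (\<exists>x\<in>X. \<exists>y\<in>K - X. E x y))"

text \<open>The path is \<open>a b c d\<close>, and \<open>e\<close> sees its middle. These edges
  and non-edges force the five vertices to be distinct.\<close>

definition no_bull :: "'a set \<Rightarrow> bool" where
  "no_bull U \<longleftrightarrow> \<not> (\<exists>a b c d e. {a, b, c, d, e} \<subseteq> U \<and>
     E a b \<and> E b c \<and> E c d \<and> E e b \<and> E e c \<and>
     \<not> E a c \<and> \<not> E a d \<and> \<not> E b d \<and> \<not> E a e \<and> \<not> E d e)"

definition mixed_on :: "'a \<Rightarrow> 'a set \<Rightarrow> bool" where
  "mixed_on r K \<longleftrightarrow> (\<exists>x\<in>K. E r x) \<and> (\<exists>x\<in>K. \<not> E r x)"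

section \<open>Complementation and elementary facts on homogeneous sets\<close>

lemma complement: "adjacency (\<lambda>x y. x \<noteq> y \<and> \<not> E x y)"
  by unfold_locales (auto dest: sym)

lemma E_commute: "E x y \<longleftrightarrow> E y x"
  using sym by blast

lemma no_bullD:
  assumes "no_bull U" "a \<in> U" "b \<in> U" "c \<in> U" "d \<in> U" "e \<in> U"
    and "E a b" "E b c" "E c d" "E e b" "E e c"
    and "\<not> E a c" "\<not> E a d" "\<not> E b d" "\<not> E a e" "\<not> E d e"
  shows False
  using assms unfolding no_bull_def by blast

text \<open>The bull is self-complementary: a path \<open>a b c d\<close> with \<open>e\<close> in
  the complement is a path \<open>c a d b\<close> with the same \<open>e\<close> in the graph. Hence
  lemmas of the locale can be dualised by interpreting it at the complement.\<close>

lemma no_bull_complement: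
  assumes "no_bull U"
  shows "adjacency.no_bull (\<lambda>x y. x \<noteq> y \<and> \<not> E x y) U"
proof -
  interpret co: adjacency "\<lambda>x y. x \<noteq> y \<and> \<not> E x y" by (rule complement)
  show ?thesis
    unfolding co.no_bull_def
  proof (rule notI, elim exE conjE)
    fix a b c d e
    assume U: "{a, b, c, d, e} \<subseteq> U"
      and "a \<noteq> b" "\<not> E a b" "b \<noteq> c" "\<not> E b c" "c \<noteq> d" "\<not> E c d"
      and "e \<noteq> b" "\<not> E e b" "e \<noteq> c" "\<not> E e c"
      and "\<not> (a \<noteq> c \<and> \<not> E a c)" "\<not> (a \<noteq> d \<and> \<not> E a d)" "\<not> (b \<noteq> d \<and> \<not> E b d)"
        "\<not> (a \<noteq> e \<and> \<not> E a e)" "\<not> (d \<noteq> e \<and> \<not> E d e)"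
    moreover from this have "a \<noteq> c" "b \<noteq> d" "a \<noteq> e" by auto
    moreover have "a \<noteq> d" using \<open>\<not> E a b\<close> \<open>\<not> (b \<noteq> d \<and> \<not> E b d)\<close> \<open>a \<noteq> b\<close> sym by blast
    moreover have "d \<noteq> e" using \<open>\<not> E e b\<close> \<open>\<not> (b \<noteq> d \<and> \<not> E b d)\<close> \<open>e \<noteq> b\<close> sym by blast
    ultimately have "E a c" "E a d" "E b d" "E a e" "E d e" by simp_all
    moreover have "\<not> E c b" "\<not> E d c" "\<not> E c e" "\<not> E b e" "\<not> E a b"
      using \<open>\<not> E a b\<close> \<open>\<not> E b c\<close> \<open>\<not> E c d\<close> \<open>\<not> E e b\<close> \<open>\<not> E e c\<close> sym by blast+
    ultimately show False
      using no_bullD[OF assms, of c a d b e] U E_commute by simp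
  qed
qed

lemma homogeneousI:
  assumes "X \<subseteq> Y"
    and "\<And>u. u \<in> Y \<Longrightarrow> u \<notin> X \<Longrightarrow> (\<forall>x\<in>X. E u x) \<or> (\<forall>x\<in>X. \<not> E u x)"
  shows "homogeneous X Y"
  using assms unfolding homogeneous_def by blast

lemma homogeneous_complement:
  "adjacency.homogeneous (\<lambda>x y. x \<noteq> y \<and> \<not> E x y) X Y \<longleftrightarrow> homogeneous X Y"
proof -
  interpret co: adjacency "\<lambda>x y. x \<noteq> y \<and> \<not> E x y" by (rule complement)
  have "(\<forall>x\<in>X. u \<noteq> x \<and> \<not> E u x) \<longleftrightarrow> (\<forall>x\<in>X. \<not> E u x)"
    "(\<forall>x\<in>X. \<not> (u \<noteq> x \<and> \<not> E u x)) \<longleftrightarrow> (\<forall>x\<in>X. E u x)" if "u \<in> Y - X" for u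
    using that by auto
  then show ?thesis unfolding homogeneous_def co.homogeneous_def
    by (metis (no_types, lifting))
qed

lemma indecomposable_complement:
  "adjacency.indecomposable (\<lambda>x y. x \<noteq> y \<and> \<not> E x y) Y \<longleftrightarrow> indecomposable Y"
proof -
  interpret co: adjacency "\<lambda>x y. x \<noteq> y \<and> \<not> E x y" by (rule complement)
  show ?thesis unfolding indecomposable_def co.indecomposable_def homogeneous_complement ..
qed

lemma indecomposable_finite: "indecomposable Y \<Longrightarrow> finite Y"
  unfolding indecomposable_def by blast

lemma indecomposable_card: "indecomposable Y \<Longrightarrow> 2 \<le> card Y"
  unfolding indecomposable_def by blast

lemma indecomposable_homogeneous:
  assumes "indecomposable Y" "homogeneous X Y" "x \<in> X" "y \<in> X" "x \<noteq> y"
  shows "X = Y"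
proof -
  have "finite X"
    using assms unfolding indecomposable_def homogeneous_def by (meson finite_subset)
  then have "\<not> card X \<le> 1"
    using assms(3-5) by (auto simp: card_le_Suc0_iff_eq)
  then show ?thesis using assms unfolding indecomposable_def by blast
qed

text \<open>Without an edge across a cut both sides are homogeneous, so each has at most one vertex.
  Two non-adjacent vertices do form an indecomposable set, hence the bound \<open>3\<close>.\<close>

lemma indecomposable_connected:
  assumes "indecomposable Y" "3 \<le> card Y"
  shows "connected_set Y"
  unfolding connected_set_def
proof (intro allI impI, rule ccontr)
  fix X assume X: "X \<subseteq> Y" "X \<noteq> {}" "X \<noteq> Y" and "\<not> (\<exists>x\<in>X. \<exists>y\<in>Y - X. E x y)"
  then have "homogeneous X Y" "homogeneous (Y - X) Y"
    unfolding homogeneous_def using sym by blast+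
  then have "card X \<le> 1" "card (Y - X) \<le> 1"
    using assms X unfolding indecomposable_def by blast+
  moreover have "card Y = card X + card (Y - X)"
    using X(1) indecomposable_finite[OF assms(1)]
    by (metis card_Diff_subset card_mono finite_subset le_add_diff_inverse)
  ultimately show False using assms(2) by linarith
qed

section \<open>Vertices mixed on a connected or indecomposable set\<close>

lemma mixed_edge:
  assumes "connected_set K" "mixed_on r K"
  obtains x y where "x \<in> K" "y \<in> K" "E x y" "E r x" "\<not> E r y"
proof -
  let ?X = "{x \<in> K. E r x}"
  have "?X \<noteq> {}" "?X \<noteq> K" "?X \<subseteq> K" using assms(2) unfolding mixed_on_def by auto
  then obtain x y where "x \<in> ?X" "y \<in> K - ?X" "E x y"
    using assms(1) unfolding connected_set_def by meson
  then show thesis using that by auto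
qed

text \<open>The components of the neighbourhood of \<open>r\<close> in \<open>K\<close> are homogeneous in \<open>K\<close>: otherwise an edge
  of such a component, \<open>r\<close>, \<open>d\<close> and a vertex distinguishing the ends of the edge induce a bull.\<close>

lemma neighbourhood_stable:
  assumes K: "indecomposable K" and bf: "no_bull U" and "K \<subseteq> U" "r \<in> U" "d \<in> U"
    and "mixed_on r K" "E d r" and d: "\<And>x. x \<in> K \<Longrightarrow> \<not> E d x"
    and "x \<in> K" "y \<in> K" "E r x" "E r y"
  shows "\<not> E x y"
proof
  assume xy: "E x y"
  define S where "S = {z \<in> K. E r z}"
  define R where "R = {(a, b). a \<in> S \<and> b \<in> S \<and> E a b}"
  define X where "X = {z. (x, z) \<in> R\<^sup>*}"
  have xX: "x \<in> X" unfolding X_def by simp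
  have yX: "y \<in> X" using assms(9-12) xy unfolding X_def R_def S_def by auto
  have XS: "X \<subseteq> S"
  proof
    fix z assume "z \<in> X"
    then have "(x, z) \<in> R\<^sup>*" unfolding X_def by simp
    then show "z \<in> S" by (induction rule: rtrancl_induct) (use assms in \<open>auto simp: R_def S_def\<close>)
  qed
  have "homogeneous X K"
  proof (rule homogeneousI)
    show "X \<subseteq> K" using XS unfolding S_def by auto
    fix u assume u: "u \<in> K" "u \<notin> X"
    show "(\<forall>x\<in>X. E u x) \<or> (\<forall>x\<in>X. \<not> E u x)"
    proof (cases "u \<in> S")
      case True
      have "\<not> E u z" if "z \<in> X" for z
      proof
        assume "E u z"
        then have "(z, u) \<in> R" using True that XS sym unfolding R_def by auto
        with \<open>z \<in> X\<close> have "u \<in> X" unfolding X_def by (auto intro: rtrancl_into_rtrancl)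
        with u show False by simp
      qed
      then show ?thesis by blast
    next
      case False
      then have ru: "\<not> E r u" using u unfolding S_def by simp
      have "E u z \<longleftrightarrow> E u x" if "z \<in> X" for z
      proof -
        have "(x, z) \<in> R\<^sup>*" using that unfolding X_def by simp
        then show ?thesis
        proof (induction rule: rtrancl_induct)
          case (step a b)
          have ab: "a \<in> K" "b \<in> K" "E r a" "E r b" "E a b"
            using step.hyps unfolding R_def S_def by auto
          have "False" if "E u p" "\<not> E u q" "p \<in> K" "q \<in> K" "E r p" "E r q" "E p q" for p q
            by (rule no_bullD[OF bf, of d r p u q])
              (use that assms u ru sym E_commute in \<open>blast+\<close>)
          then have "E u a \<longleftrightarrow> E u b" using ab sym by blast
          then show ?case using step.IH by blast
        qed simp
      qed
      then show ?thesis by blast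
    qed
  qed
  then have "X = K"
    using indecomposable_homogeneous[OF K _ xX yX] xy irrefl by blast
  then show False using XS \<open>mixed_on r K\<close> unfolding mixed_on_def S_def by blast
qed

text \<open>Stability of the neighbourhood, read in the complement: there \<open>c\<close> is
  anticomplete to \<open>K\<close> and takes the role of \<open>d\<close>.\<close>

lemma non_neighbourhood_clique:
  assumes K: "indecomposable K" and bf: "no_bull U" and "K \<subseteq> U" "r \<in> U" "c \<in> U" "r \<notin> K" "c \<notin> K"
    and "mixed_on r K" "c \<noteq> r" "\<not> E c r" and c: "\<And>x. x \<in> K \<Longrightarrow> E c x"
    and "x \<in> K" "y \<in> K" "\<not> E r x" "\<not> E r y" "x \<noteq> y"
  shows "E x y"
proof -
  interpret co: adjacency "\<lambda>x y. x \<noteq> y \<and> \<not> E x y" by (rule complement)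
  have "co.mixed_on r K"
    using \<open>mixed_on r K\<close> \<open>r \<notin> K\<close> unfolding mixed_on_def co.mixed_on_def by metis
  moreover have "co.indecomposable K" "co.no_bull U"
    using K bf indecomposable_complement no_bull_complement by auto
  ultimately have "\<not> (x \<noteq> y \<and> \<not> E x y)"
    by - (rule co.neighbourhood_stable[where U = U and K = K and r = r and d = c]; use assms in auto)
  then show ?thesis using \<open>x \<noteq> y\<close> by blast
qed

text \<open>If there is no such \<open>p\<close>, then \<open>W\<close> below is a nontrivial homogeneous set containing \<open>K\<close>.\<close>

lemma anchored_mixed_vertex:
  assumes R: "indecomposable R" and bf: "no_bull R" and "K \<subseteq> R" and con: "connected_set K"
    and "2 \<le> card K" and d: "d \<in> R" "d \<notin> K" "\<And>x. x \<in> K \<Longrightarrow> \<not> E d x"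
  obtains p g where "p \<in> R - K" "g \<in> R - K" "mixed_on p K" "E g p" "\<forall>x\<in>K. \<not> E g x"
proof (rule ccontr)
  assume neg: "\<not> thesis"
  note witness = that
  define D where "D = {g \<in> R - K. \<forall>x\<in>K. \<not> E g x}"
  have mix: "\<not> E g p" if "p \<in> R - K" "mixed_on p K" "g \<in> D" for p g
  proof
    assume "E g p"
    have g: "g \<in> R - K" "\<forall>x\<in>K. \<not> E g x" using that(3) unfolding D_def by auto
    have thesis by (rule witness[OF that(1) g(1) that(2) \<open>E g p\<close> g(2)])
    with neg show False ..
  qed
  \<comment> \<open>\<open>C1\<close> holds the complete vertices seen by \<open>D\<close>. Complete
    vertices that miss a member of \<open>C1\<close> join \<open>A\<close>, so that those left in
    \<open>W\<close> are complete to \<open>C1\<close>. The goal is that \<open>D\<close> is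
    anticomplete and \<open>A\<close> complete to \<open>W\<close>.\<close>
  define C where "C = {c \<in> R - K. \<forall>x\<in>K. E c x}"
  define C1 where "C1 = {c \<in> C. \<exists>g\<in>D. E g c}"
  define A where "A = C1 \<union> {c \<in> C. \<exists>c1\<in>C1. \<not> E c c1}"
  define W where "W = R - (D \<union> A)"
  obtain k k' where k: "k \<in> K" "k' \<in> K" "k \<noteq> k'"
    using card2_distinct \<open>2 \<le> card K\<close> \<open>K \<subseteq> R\<close> R indecomposable_finite finite_subset by metis
  have "K \<subseteq> W" using \<open>K \<subseteq> R\<close> unfolding W_def D_def A_def C1_def C_def by auto
  have W_cases: "w \<in> K \<or> (w \<in> C \<and> w \<notin> A) \<or> (w \<in> R - K \<and> mixed_on w K)" if "w \<in> W" for w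
    using that unfolding W_def D_def C_def mixed_on_def by auto
  have D: "\<not> E u w" if "u \<in> D" "w \<in> W" for u w
    using W_cases[OF that(2)] that mix unfolding A_def C1_def D_def by blast
  have C1: "E u w" if "u \<in> C1" "w \<in> W" for u w
  proof -
    have u: "u \<in> R" "\<And>x. x \<in> K \<Longrightarrow> E u x" using that(1) unfolding C1_def C_def by auto
    obtain g where g: "g \<in> D" "E g u" using \<open>u \<in> C1\<close> unfolding C1_def by blast
    have gW: "\<not> E g w" using D[OF g(1) that(2)] .
    have gR: "g \<in> R" "\<And>x. x \<in> K \<Longrightarrow> \<not> E g x" using g unfolding D_def by auto
    consider "w \<in> K" | "w \<in> C" "w \<notin> A" | "w \<in> R - K" "mixed_on w K"
      using W_cases[OF \<open>w \<in> W\<close>] by blast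
    then show ?thesis
    proof cases
      case 2
      then show ?thesis using that(1) sym unfolding A_def by blast
    next
      case 3
      \<comment> \<open>The edge \<open>x y\<close> crosses the neighbourhood of \<open>w\<close>.
        If \<open>u\<close> missed \<open>w\<close>, then \<open>g u x w\<close> would be a path
        with \<open>y\<close> adjacent to its middle.\<close>
      obtain x y where xy: "x \<in> K" "y \<in> K" "E x y" "E w x" "\<not> E w y"
        using mixed_edge[OF con 3(2)] .
      show ?thesis
      proof (rule ccontr)
        assume "\<not> E u w"
        then show False
          by (intro no_bullD[OF bf, of g u x w y])
            (use 3 xy u g gW gR \<open>K \<subseteq> R\<close> sym in \<open>blast+\<close>)
      qed
    qed (use u in blast)
  qed
  have A: "E u w" if "u \<in> A" "w \<in> W" for u w
  proof (cases "u \<in> C1")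
    case False
    then obtain c1 where c1: "c1 \<in> C1" "\<not> E u c1" and uC: "u \<in> C"
      using \<open>u \<in> A\<close> unfolding A_def by blast
    have u: "u \<in> R" "\<And>x. x \<in> K \<Longrightarrow> E u x" using uC unfolding C_def by auto
    have c1': "c1 \<in> R" "\<And>x. x \<in> K \<Longrightarrow> E c1 x" using c1 unfolding C1_def C_def by auto
    obtain g where g: "g \<in> D" "E g c1" using c1(1) unfolding C1_def by blast
    have gW: "\<not> E g w" using D[OF g(1) that(2)] .
    have gR: "g \<in> R" "\<And>x. x \<in> K \<Longrightarrow> \<not> E g x" using g unfolding D_def by auto
    have gu: "\<not> E g u" using False uC g unfolding C1_def by blast
    have c1w: "E c1 w" using C1[OF c1(1) that(2)] .
    have wR: "w \<in> R" using that(2) unfolding W_def by blast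
    \<comment> \<open>For \<open>w\<close> in \<open>K\<close> the claim holds as \<open>u\<close>
      is complete to \<open>K\<close>. Any other \<open>w\<close> has a neighbour \<open>x\<close>
      in \<open>K\<close>, and a missing edge \<open>u w\<close> makes \<open>g c1 x u\<close> a
      path with \<open>w\<close> adjacent to its middle.\<close>
    obtain x where x: "x \<in> K" "w \<in> K \<or> E w x"
      using W_cases[OF \<open>w \<in> W\<close>] k(1) unfolding C_def mixed_on_def by auto
    show ?thesis
    proof (rule ccontr)
      assume nuw: "\<not> E u w"
      then have "E w x" using x u sym by blast
      then show False
        by (intro no_bullD[OF bf, of g c1 x u w])
          (use nuw x u c1 c1' c1w wR gu g gW gR \<open>K \<subseteq> R\<close> sym in \<open>blast+\<close>)
    qed
  qed (use C1 that in blast)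
  have "homogeneous W R"
  proof (rule homogeneousI)
    show "W \<subseteq> R" unfolding W_def by auto
    fix u assume "u \<in> R" "u \<notin> W"
    then have "u \<in> D \<or> u \<in> A" unfolding W_def by blast
    then show "(\<forall>x\<in>W. E u x) \<or> (\<forall>x\<in>W. \<not> E u x)" using D A by blast
  qed
  then have "W = R" using indecomposable_homogeneous[OF R] k \<open>K \<subseteq> W\<close> by blast
  then show False using d unfolding W_def D_def by blast
qed

text \<open>The complementary form of \<open>anchored_mixed_vertex\<close>; three vertices make
  \<open>K\<close> connected in the complement as well.\<close>

lemma coanchored_mixed_vertex:
  assumes R: "indecomposable R" and bf: "no_bull R" and "K \<subseteq> R"
    and K: "indecomposable K" "3 \<le> card K" and d: "d \<in> R" "d \<notin> K" "\<And>x. x \<in> K \<Longrightarrow> E d x"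
  obtains p g where "p \<in> R - K" "g \<in> R - K" "mixed_on p K" "\<not> E g p" "g \<noteq> p" "\<forall>x\<in>K. E g x"
proof -
  interpret co: adjacency "\<lambda>x y. x \<noteq> y \<and> \<not> E x y" by (rule complement)
  have "co.connected_set K"
    using co.indecomposable_connected K indecomposable_complement by blast
  then obtain p g where pg: "p \<in> R - K" "g \<in> R - K" "co.mixed_on p K" "g \<noteq> p \<and> \<not> E g p"
    "\<forall>x\<in>K. \<not> (g \<noteq> x \<and> \<not> E g x)"
  proof (rule co.anchored_mixed_vertex[rotated 3])
    show "co.indecomposable R" "co.no_bull R" "2 \<le> card K" "K \<subseteq> R" "d \<in> R" "d \<notin> K"
      using R bf K \<open>K \<subseteq> R\<close> d indecomposable_complement no_bull_complement by auto
    show "\<And>x. x \<in> K \<Longrightarrow> \<not> (d \<noteq> x \<and> \<not> E d x)" using d by blast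
  qed blast
  have "mixed_on p K" using pg(1,3) unfolding mixed_on_def co.mixed_on_def by auto
  moreover have "\<forall>x\<in>K. E g x" using pg(2,5) by auto
  ultimately show thesis using that pg(1,2,4) by blast
qed

text \<open>It suffices to find one mixed \<open>r\<close> with a neighbour \<open>d\<close>
  anticomplete to \<open>K\<close> and a non-neighbour \<open>c\<close> complete to
  \<open>K\<close>: the neighbours of \<open>r\<close> in \<open>K\<close> are then stable and its
  non-neighbours a clique. The lemmas on mixed vertices supply \<open>d\<close> and \<open>c\<close>
  only for possibly different \<open>r\<close>.\<close>

lemma split_between_centre_and_anticentre:
  assumes R: "indecomposable R" and bf: "no_bull R" and "K \<subseteq> R"
    and K: "indecomposable K" "3 \<le> card K"
    and c: "c \<in> R" "c \<notin> K" "\<And>x. x \<in> K \<Longrightarrow> E c x"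
    and d: "d \<in> R" "d \<notin> K" "\<And>x. x \<in> K \<Longrightarrow> \<not> E d x"
  obtains S where "S \<subseteq> K" "\<And>x y. x \<in> S \<Longrightarrow> y \<in> S \<Longrightarrow> \<not> E x y" "pairwise E (K - S)"
proof -
  have con: "connected_set K" using indecomposable_connected K by blast
  define C where "C = {c \<in> R - K. \<forall>x\<in>K. E c x}"
  define D where "D = {d \<in> R - K. \<forall>x\<in>K. \<not> E d x}"
  have "2 \<le> card K" using K by simp
  obtain r1 d1 where r1: "r1 \<in> R - K" "d1 \<in> R - K" "mixed_on r1 K" "E d1 r1"
      "\<forall>x\<in>K. \<not> E d1 x"
    using anchored_mixed_vertex[OF R bf \<open>K \<subseteq> R\<close> con \<open>2 \<le> card K\<close> d] .
  obtain r2 c2 where r2: "r2 \<in> R - K" "c2 \<in> R - K" "mixed_on r2 K" "\<not> E c2 r2" "c2 \<noteq> r2"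
      "\<forall>x\<in>K. E c2 x"
    using coanchored_mixed_vertex[OF R bf \<open>K \<subseteq> R\<close> K c] .
  have "d1 \<in> D" "c2 \<in> C" using r1 r2 unfolding C_def D_def by auto
  \<comment> \<open>Otherwise \<open>r1\<close> forces \<open>d1\<close> to be adjacent to \<open>c2\<close>, and \<open>r2\<close> forces the opposite.\<close>
  have "\<exists>r c d. r \<in> R - K \<and> mixed_on r K \<and> c \<in> C \<and> d \<in> D \<and> E d r \<and> \<not> E c r"
  proof (rule ccontr)
    assume neg: "\<not> ?thesis"
    have 1: "E c2 r1" using neg r1 \<open>d1 \<in> D\<close> \<open>c2 \<in> C\<close> by blast
    have 2: "\<not> E d1 r2" using neg r2 \<open>d1 \<in> D\<close> \<open>c2 \<in> C\<close> by blast
    \<comment> \<open>\<open>K\<close> is also connected in the complement, so \<open>r1\<close>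
      separates the ends of some non-edge.\<close>
    have co_edge: "\<exists>x\<in>K. \<exists>y\<in>K. \<not> E x y \<and> E r1 x \<and> \<not> E r1 y"
    proof -
      interpret co: adjacency "\<lambda>x y. x \<noteq> y \<and> \<not> E x y" by (rule complement)
      have "co.connected_set K"
        using co.indecomposable_connected K indecomposable_complement by blast
      moreover have "co.mixed_on r1 K"
        using r1(1,3) unfolding mixed_on_def co.mixed_on_def by auto
      ultimately obtain x y where "x \<in> K" "y \<in> K" "\<not> E x y" "\<not> E r1 x" "\<not> (r1 \<noteq> y \<and> \<not> E r1 y)"
        by (rule co.mixed_edge) blast
      moreover from this r1 have "E r1 y" by blast
      ultimately show ?thesis using sym by blast
    qed
    \<comment> \<open>Otherwise \<open>d1 r1 c2 y\<close> is a path and \<open>x\<close> sees its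
      middle.\<close>
    have "E c2 d1"
    proof (rule ccontr)
      assume n: "\<not> E c2 d1"
      obtain x y where xy: "x \<in> K" "y \<in> K" "\<not> E x y" "E r1 x" "\<not> E r1 y" using co_edge by blast
      show False
        by (rule no_bullD[OF bf, of d1 r1 c2 y x])
          (use n xy r1 r2 1 \<open>K \<subseteq> R\<close> sym in \<open>blast+\<close>)
    qed
    \<comment> \<open>With this edge, \<open>d1 c2 x r2\<close> is a path and \<open>y\<close> sees
      its middle.\<close>
    obtain x y where xy: "x \<in> K" "y \<in> K" "E x y" "E r2 x" "\<not> E r2 y"
      using mixed_edge[OF con r2(3)] .
    show False
      by (rule no_bullD[OF bf, of d1 c2 x r2 y])
        (use \<open>E c2 d1\<close> xy r1 r2 2 \<open>K \<subseteq> R\<close> sym in \<open>blast+\<close>)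
  qed
  then obtain r c d where r: "r \<in> R - K" "mixed_on r K" "c \<in> C" "d \<in> D" "E d r" "\<not> E c r"
    by blast
  define S where "S = {x \<in> K. E r x}"
  show thesis
  proof (rule that)
    show "S \<subseteq> K" unfolding S_def by auto
    show "\<not> E x y" if "x \<in> S" "y \<in> S" for x y
      using neighbourhood_stable[OF K(1) bf \<open>K \<subseteq> R\<close>, of r d x y] r that
      unfolding S_def D_def by blast
    have "c \<noteq> r" using r unfolding C_def mixed_on_def by blast
    then show "pairwise E (K - S)"
      using non_neighbourhood_clique[OF K(1) bf \<open>K \<subseteq> R\<close>, of r c] r
      unfolding S_def C_def pairwise_def by blast
  qed
qed

subsection \<open>Colouring and substitution\<close>

definition omega :: "'a set \<Rightarrow> nat" where
  "omega X = Max (card ` {K. K \<subseteq> X \<and> pairwise E K})"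

definition colourable :: "'a set \<Rightarrow> nat \<Rightarrow> bool" where
  "colourable X k \<longleftrightarrow> (\<exists>c. c ` X \<subseteq> {..<k} \<and> (\<forall>x\<in>X. \<forall>y\<in>X. E x y \<longrightarrow> c x \<noteq> c y))"

section \<open>Clique numbers and colourings of vertex sets\<close>

lemma omega_ge:
  assumes "finite X" "K \<subseteq> X" "pairwise E K"
  shows "card K \<le> omega X"
  unfolding omega_def by (rule Max_ge) (use assms in auto)

lemma omega_clique:
  assumes "finite X"
  obtains K where "K \<subseteq> X" "pairwise E K" "card K = omega X"
proof -
  have "omega X \<in> card ` {K. K \<subseteq> X \<and> pairwise E K}"
    unfolding omega_def by (rule Max_in) (use assms in \<open>auto intro: exI[of _ "{}"]\<close>)
  then show thesis using that by auto
qed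

lemma omega_mono:
  assumes "finite Y" "X \<subseteq> Y"
  shows "omega X \<le> omega Y"
  using omega_clique[of X] omega_ge[of Y] assms by (metis finite_subset order_trans)

lemma omega_empty: "omega {} = 0"
  using omega_clique[of "{}"] by (metis card.empty finite.emptyI subset_empty)

lemma omega_pos:
  assumes "finite X" "x \<in> X"
  shows "1 \<le> omega X"
  using omega_ge[of X "{x}"] assms by (simp add: pairwise_def)

lemma pairwise_insert_E:
  assumes "pairwise E K" "\<And>x. x \<in> K \<Longrightarrow> E v x"
  shows "pairwise E (insert v K)"
  using assms sym by (auto simp: pairwise_insert)

lemma colourableE:
  assumes "colourable X k"
  obtains c where "\<And>x. x \<in> X \<Longrightarrow> c x < k" "\<And>x y. x \<in> X \<Longrightarrow> y \<in> X \<Longrightarrow> E x y \<Longrightarrow> c x \<noteq> (c y :: nat)"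
  using assms unfolding colourable_def by blast

lemma colourableI:
  assumes "\<And>x. x \<in> X \<Longrightarrow> c x < k" "\<And>x y. x \<in> X \<Longrightarrow> y \<in> X \<Longrightarrow> E x y \<Longrightarrow> c x \<noteq> (c y :: nat)"
  shows "colourable X k"
  using assms unfolding colourable_def by blast

lemma colourable_mono:
  assumes "colourable Y l" "X \<subseteq> Y" "l \<le> k"
  shows "colourable X k"
proof -
  obtain c where "\<And>x. x \<in> Y \<Longrightarrow> c x < l" "\<And>x y. x \<in> Y \<Longrightarrow> y \<in> Y \<Longrightarrow> E x y \<Longrightarrow> c x \<noteq> (c y :: nat)"
    by (rule colourableE[OF assms(1)]) blast
  then show ?thesis using assms(2,3) by (intro colourableI[where c = c]) (fastforce dest: subsetD)+
qed

lemma colourable_card: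
  assumes "finite X"
  shows "colourable X (card X)"
proof -
  obtain c where c: "bij_betw c X {0..<card X}" using ex_bij_betw_finite_nat[OF assms] by blast
  show ?thesis
  proof (rule colourableI[where c = c])
    show "c x < card X" if "x \<in> X" for x using c that unfolding bij_betw_def by auto
    show "c x \<noteq> c y" if "x \<in> X" "y \<in> X" "E x y" for x y
      using c that irrefl unfolding bij_betw_def inj_on_def by metis
  qed
qed

lemma colourable_Un:
  assumes "colourable X k" "colourable Y l"
  shows "colourable (X \<union> Y) (k + l)"
proof -
  obtain c where c: "\<And>x. x \<in> X \<Longrightarrow> c x < k" "\<And>x y. x \<in> X \<Longrightarrow> y \<in> X \<Longrightarrow> E x y \<Longrightarrow> c x \<noteq> (c y :: nat)"
    by (rule colourableE[OF assms(1)]) blast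
  obtain d where d: "\<And>x. x \<in> Y \<Longrightarrow> d x < l" "\<And>x y. x \<in> Y \<Longrightarrow> y \<in> Y \<Longrightarrow> E x y \<Longrightarrow> d x \<noteq> (d y :: nat)"
    by (rule colourableE[OF assms(2)]) blast
  show ?thesis
  proof (rule colourableI[where c = "\<lambda>x. if x \<in> X then c x else k + d x"])
    show "(if x \<in> X then c x else k + d x) < k + l" if "x \<in> X \<union> Y" for x
      using c(1)[of x] d(1)[of x] that by auto
    show "(if x \<in> X then c x else k + d x) \<noteq> (if y \<in> X then c y else k + d y)"
      if "x \<in> X \<union> Y" "y \<in> X \<union> Y" "E x y" for x y
      using c(1)[of x] c(1)[of y] c(2)[of x y] d(2)[of x y] that by auto
  qed
qed

lemma colourable_stable:
  assumes "\<And>x y. x \<in> X \<Longrightarrow> y \<in> X \<Longrightarrow> \<not> E x y"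
  shows "colourable X 1"
  by (rule colourableI[where c = "\<lambda>_. 0"]) (use assms in auto)

text \<open>A partition into homogeneous classes, encoded by an idempotent choice of
  representatives. Adjacency between classes is read off the representatives, so the quotient is the
  graph induced on them.\<close>

definition quotient_map :: "'a set \<Rightarrow> ('a \<Rightarrow> 'a) \<Rightarrow> bool" where
  "quotient_map Y \<rho> \<longleftrightarrow> \<rho> ` Y \<subseteq> Y \<and> (\<forall>x\<in>Y. \<rho> (\<rho> x) = \<rho> x) \<and>
     (\<forall>x\<in>Y. \<forall>y\<in>Y. \<rho> x \<noteq> \<rho> y \<longrightarrow> (E x y \<longleftrightarrow> E (\<rho> x) (\<rho> y)))"

text \<open>Take a quotient with the least number \<open>\<ge> 2\<close> of classes.\<close>

lemma indecomposable_quotient: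
  assumes "finite Y" "2 \<le> card Y"
  obtains \<rho> where "quotient_map Y \<rho>" "indecomposable (\<rho> ` Y)"
proof -
  define Q where "Q \<rho> \<longleftrightarrow> quotient_map Y \<rho> \<and> 2 \<le> card (\<rho> ` Y)" for \<rho>
  have "Q id" unfolding Q_def quotient_map_def using assms by simp
  then obtain \<rho> where \<rho>: "Q \<rho>" and least: "\<And>\<sigma>. Q \<sigma> \<Longrightarrow> card (\<rho> ` Y) \<le> card (\<sigma> ` Y)"
    using ex_has_least_nat[of Q id "\<lambda>\<rho>. card (\<rho> ` Y)"] by blast
  have q: "quotient_map Y \<rho>" "2 \<le> card (\<rho> ` Y)" using \<rho> unfolding Q_def by auto
  have "indecomposable (\<rho> ` Y)"
    unfolding indecomposable_def
  proof (intro conjI allI impI)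
    fix W assume W: "homogeneous W (\<rho> ` Y)"
    then have WR: "W \<subseteq> \<rho> ` Y" unfolding homogeneous_def by blast
    show "card W \<le> 1 \<or> W = \<rho> ` Y"
    proof (rule ccontr)
      assume neg: "\<not> ?thesis"
      have finW: "finite W" using WR assms(1) finite_subset by blast
      obtain w where w: "w \<in> W" using neg by force
      \<comment> \<open>All classes with representatives in \<open>W\<close> are merged. As
        \<open>W\<close> has two elements, this lowers the number of classes; as \<open>W\<close> is
        not everything, at least two remain.\<close>
      define \<sigma> where "\<sigma> x = (if \<rho> x \<in> W then w else \<rho> x)" for x
      have wY: "w \<in> Y" "\<rho> w = w" using w WR q(1) unfolding quotient_map_def by auto
      have "quotient_map Y \<sigma>"
        unfolding quotient_map_def
      proof (intro conjI ballI impI)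
        show "\<sigma> ` Y \<subseteq> Y" using wY q(1) unfolding \<sigma>_def quotient_map_def by auto
        show "\<sigma> (\<sigma> x) = \<sigma> x" if "x \<in> Y" for x
          using that wY w q(1) unfolding \<sigma>_def quotient_map_def by auto
        show "E x y \<longleftrightarrow> E (\<sigma> x) (\<sigma> y)" if xy: "x \<in> Y" "y \<in> Y" "\<sigma> x \<noteq> \<sigma> y" for x y
        proof -
          have "\<rho> x \<noteq> \<rho> y" using xy(3) unfolding \<sigma>_def by metis
          then have 1: "E x y \<longleftrightarrow> E (\<rho> x) (\<rho> y)" using q(1) xy unfolding quotient_map_def by blast
          have 2: "E (\<rho> u) v \<longleftrightarrow> E (\<rho> u) v'" if "u \<in> Y" "\<rho> u \<notin> W" "v \<in> W" "v' \<in> W" for u v v'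
            using W that unfolding homogeneous_def by blast
          show ?thesis
            using 1 2[of x "\<rho> y" w] 2[of y "\<rho> x" w] xy w E_commute[of "\<rho> y"] unfolding \<sigma>_def
            by (auto split: if_splits)
        qed
      qed
      moreover have "\<sigma> ` Y = insert w (\<rho> ` Y - W)"
        using WR w unfolding \<sigma>_def by (auto simp: image_iff)
      moreover have "card (insert w (\<rho> ` Y - W)) = Suc (card (\<rho> ` Y - W))"
        using w assms(1) by simp
      moreover have "card (\<rho> ` Y - W) = card (\<rho> ` Y) - card W"
        using card_Diff_subset[OF finW WR] .
      moreover have "card W < card (\<rho> ` Y)"
        using psubset_card_mono[of "\<rho> ` Y" W] neg WR assms(1) by blast
      ultimately have "Q \<sigma>" "card (\<sigma> ` Y) < card (\<rho> ` Y)"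
        using neg unfolding Q_def by auto
      then show False using least by fastforce
    qed
  qed (use q assms in auto)
  then show thesis using that q by blast
qed

definition fibre :: "('a \<Rightarrow> 'a) \<Rightarrow> 'a set \<Rightarrow> 'a \<Rightarrow> 'a set" where
  "fibre \<rho> Y r = {x \<in> Y. \<rho> x = r}"

lemma quotient_rep:
  assumes "quotient_map Y \<rho>" "r \<in> \<rho> ` Y"
  shows "r \<in> Y" "\<rho> r = r" "r \<in> fibre \<rho> Y r"
  using assms unfolding quotient_map_def fibre_def by auto

lemma quotient_edge:
  assumes "quotient_map Y \<rho>" "x \<in> Y" "y \<in> Y" "\<rho> x \<noteq> \<rho> y"
  shows "E x y \<longleftrightarrow> E (\<rho> x) (\<rho> y)"
  using assms unfolding quotient_map_def by blast

lemma fibre_smaller: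
  assumes "finite Y" "quotient_map Y \<rho>" "2 \<le> card (\<rho> ` Y)"
  shows "card (fibre \<rho> Y r) < card Y"
proof (rule psubset_card_mono[OF assms(1)])
  obtain s where "s \<in> \<rho> ` Y" "s \<noteq> r"
    using card2_distinct[of "\<rho> ` Y"] assms by (metis finite_imageI)
  then show "fibre \<rho> Y r \<subset> Y"
    using quotient_rep[OF assms(2)] unfolding fibre_def by blast
qed

lemma fibre_homogeneous:
  assumes q: "quotient_map Y \<rho>" and "P \<subseteq> Y"
  shows "homogeneous (P \<inter> fibre \<rho> Y r) P"
proof (rule homogeneousI)
  fix u assume u: "u \<in> P" "u \<notin> P \<inter> fibre \<rho> Y r"
  then have "E u x \<longleftrightarrow> E (\<rho> u) r" if "x \<in> P \<inter> fibre \<rho> Y r" for x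
    using quotient_edge[OF q, of u x] that \<open>P \<subseteq> Y\<close> unfolding fibre_def by blast
  then show "(\<forall>x\<in>P \<inter> fibre \<rho> Y r. E u x) \<or> (\<forall>x\<in>P \<inter> fibre \<rho> Y r. \<not> E u x)" by blast
qed auto

text \<open>Maximum cliques of the fibres over a clique of representatives unite to one clique.
  Clique numbers of fibres thus serve as weights.\<close>

lemma weighted_clique:
  assumes fin: "finite Y" and q: "quotient_map Y \<rho>" and Z: "Z \<subseteq> \<rho> ` Y" "pairwise E Z"
  shows "(\<Sum>r\<in>Z. omega (fibre \<rho> Y r)) \<le> omega Y"
proof -
  have finf: "finite (fibre \<rho> Y r)" for r using fin unfolding fibre_def by simp
  have "\<exists>K. K \<subseteq> fibre \<rho> Y r \<and> pairwise E K \<and> card K = omega (fibre \<rho> Y r)" for r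
    using omega_clique[OF finf[of r]] by metis
  then obtain K where K: "\<And>r. K r \<subseteq> fibre \<rho> Y r" "\<And>r. pairwise E (K r)"
    "\<And>r. card (K r) = omega (fibre \<rho> Y r)"
    by metis
  have "pairwise E (\<Union>r\<in>Z. K r)"
    unfolding pairwise_def
  proof (intro ballI impI)
    fix x y assume "x \<in> (\<Union>r\<in>Z. K r)" "y \<in> (\<Union>r\<in>Z. K r)" "x \<noteq> y"
    then obtain r s where rs: "r \<in> Z" "s \<in> Z" "x \<in> K r" "y \<in> K s" by blast
    then have xy: "x \<in> Y" "y \<in> Y" "\<rho> x = r" "\<rho> y = s" using K(1) unfolding fibre_def by auto
    show "E x y"
    proof (cases "r = s")
      case True
      then show ?thesis using K(2)[of r] rs \<open>x \<noteq> y\<close> unfolding pairwise_def by blast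
    next
      case False
      then show ?thesis using quotient_edge[OF q xy(1,2)] xy rs Z(2) unfolding pairwise_def by blast
    qed
  qed
  moreover have "(\<Union>r\<in>Z. K r) \<subseteq> Y" using K(1) unfolding fibre_def by blast
  ultimately have "card (\<Union>r\<in>Z. K r) \<le> omega Y" using omega_ge[OF fin] by blast
  moreover have "card (\<Union>r\<in>Z. K r) = (\<Sum>r\<in>Z. card (K r))"
  proof (rule card_UN_disjoint)
    show "finite Z" using Z(1) fin finite_subset by blast
    show "\<forall>r\<in>Z. finite (K r)" using K(1) finf finite_subset by blast
    show "\<forall>r\<in>Z. \<forall>s\<in>Z. r \<noteq> s \<longrightarrow> K r \<inter> K s = {}" using K(1) unfolding fibre_def by blast
  qed
  ultimately show ?thesis using K(3) by simp
qed

text \<open>All subsets are included because the substitution argument colours sets of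
  representatives of similar weight. The constant is a power of two to match
  \<open>palette_term\<close>.\<close>

definition well_coloured :: "nat \<Rightarrow> nat \<Rightarrow> 'a set \<Rightarrow> bool" where
  "well_coloured c b P \<longleftrightarrow> (\<forall>Z\<subseteq>P. colourable Z (2 ^ c * omega Z ^ b))"

text \<open>Induction along an indecomposable quotient, weighting a representative by the clique
  number of its fibre. Fibres heavier than \<open>n / 2\<close> are pairwise non-adjacent and all
  use the lowest colours. Lighter ones are grouped by weight up to a factor two; each group owns a
  block of colours near the top, in which a colour is a pair: one colour of the representative and
  one of the vertex in its fibre.\<close>

lemma substitution_colourable:
  assumes "finite Y" and a: "2 * b + c + 3 \<le> a"
    and "\<And>P. P \<subseteq> Y \<Longrightarrow> indecomposable P \<Longrightarrow> well_coloured c b P"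
  shows "colourable Y (omega Y ^ a)"
  using assms(1,3)
proof (induction "card Y" arbitrary: Y rule: less_induct)
  case less
  note fin = less.prems(1)
  consider "Y = {}" | y where "Y = {y}" | "2 \<le> card Y"
  proof -
    have "card Y = 0 \<or> card Y = 1 \<or> 2 \<le> card Y" by linarith
    then show thesis using that fin by (auto simp: card_1_singleton_iff)
  qed
  then show ?case
  proof cases
    case 1
    then show ?thesis by (simp add: colourable_def)
  next
    case 2
    have "colourable Y 1" using 2 irrefl by (intro colourable_stable) auto
    moreover have "1 \<le> omega Y ^ a" using omega_pos[OF fin, of y] 2 by (simp add: one_le_power)
    ultimately show ?thesis using colourable_mono by blast
  next
    case 3
    obtain \<rho> where q: "quotient_map Y \<rho>" and R: "indecomposable (\<rho> ` Y)"
      using indecomposable_quotient[OF fin 3] .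
    define n where "n = omega Y"
    define w where "w r = omega (fibre \<rho> Y r)" for r
    have finf: "finite (fibre \<rho> Y r)" for r using fin unfolding fibre_def by simp
    have finR: "finite (\<rho> ` Y)" using fin by blast
    have RY: "\<rho> ` Y \<subseteq> Y" using q unfolding quotient_map_def by blast
    have w1: "1 \<le> w r" if "r \<in> \<rho> ` Y" for r
      using omega_pos[OF finf] quotient_rep(3)[OF q that] unfolding w_def by blast
    have wn: "w r \<le> n" for r
      unfolding w_def n_def by (rule omega_mono[OF fin]) (auto simp: fibre_def)
    have wsum: "(\<Sum>r\<in>Z. w r) \<le> n" if "Z \<subseteq> \<rho> ` Y" "pairwise E Z" for Z
      using weighted_clique[OF fin q that] unfolding w_def n_def .
    have wedge: "w r + w s \<le> n" if "r \<in> \<rho> ` Y" "s \<in> \<rho> ` Y" "E r s" for r s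
    proof -
      have "r \<noteq> s" using that irrefl by blast
      then show ?thesis using wsum[of "{r, s}"] that sym by (simp add: pairwise_def)
    qed
    have "\<exists>f. \<forall>x\<in>fibre \<rho> Y r. f x < w r ^ a \<and> (\<forall>y\<in>fibre \<rho> Y r. E x y \<longrightarrow> f x \<noteq> (f y :: nat))" for r
    proof -
      have "colourable (fibre \<rho> Y r) (w r ^ a)"
        unfolding w_def
      proof (rule less.hyps)
        show "card (fibre \<rho> Y r) < card Y"
          using fibre_smaller[OF fin q indecomposable_card[OF R]] .
        show "well_coloured c b P" if "P \<subseteq> fibre \<rho> Y r" "indecomposable P" for P
          using less.prems(2)[OF _ that(2)] that(1) unfolding fibre_def by blast
      qed (rule finf)
      then show ?thesis by (rule colourableE) blast
    qed
    then obtain f where f: "\<And>r x. x \<in> fibre \<rho> Y r \<Longrightarrow> f r x < w r ^ a"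
      "\<And>r x y. x \<in> fibre \<rho> Y r \<Longrightarrow> y \<in> fibre \<rho> Y r \<Longrightarrow> E x y \<Longrightarrow> f r x \<noteq> (f r y :: nat)"
      by metis
    \<comment> \<open>Level \<open>k\<close> means that \<open>w r\<close> lies above
      \<open>n / 2 ^ (k + 1)\<close> and not above \<open>n / 2 ^ k\<close>; level \<open>0\<close>
      consists of the heavy fibres.\<close>
    define lev where "lev r = (LEAST k. n < 2 ^ (k + 1) * w r)" for r
    have lev_ub: "n < 2 ^ (lev r + 1) * w r" if "r \<in> \<rho> ` Y" for r
    proof -
      have "n < 2 ^ (n + 1)" using less_exp[of "n + 1"] by linarith
      also have "\<dots> \<le> 2 ^ (n + 1) * w r" using w1[OF that] by simp
      finally show ?thesis unfolding lev_def by (rule LeastI)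
    qed
    have lev_lb: "2 ^ lev r * w r \<le> n" if "lev r \<noteq> 0" for r
    proof -
      obtain k where k: "lev r = Suc k" using \<open>lev r \<noteq> 0\<close> not0_implies_Suc by blast
      then have "\<not> n < 2 ^ (k + 1) * w r"
        using not_less_Least[of k "\<lambda>k. n < 2 ^ (k + 1) * w r"] unfolding lev_def by simp
      then show ?thesis using k by simp
    qed
    define good where "good k h \<longleftrightarrow> (\<forall>r\<in>\<rho> ` Y. lev r = k \<longrightarrow> h r < 2 ^ c * (2 ^ (k + 1)) ^ b \<and>
        (\<forall>s\<in>\<rho> ` Y. lev s = k \<longrightarrow> E r s \<longrightarrow> h r \<noteq> (h s :: nat)))" for k h
    have "\<exists>h. good k h" for k
    proof -
      define Z where "Z = {r \<in> \<rho> ` Y. lev r = k}"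
      have finZ: "finite Z" using finR unfolding Z_def by simp
      \<comment> \<open>A clique on level \<open>k\<close> has total weight at most
        \<open>n\<close>, while each of its vertices weighs at least
        \<open>n / 2 ^ (k + 1)\<close>.\<close>
      have "omega Z \<le> 2 ^ (k + 1)"
      proof -
        obtain K where K: "K \<subseteq> Z" "pairwise E K" "card K = omega Z" using omega_clique[OF finZ] .
        have "card K * n = (\<Sum>r\<in>K. n)" by simp
        also have "\<dots> \<le> (\<Sum>r\<in>K. 2 ^ (k + 1) * w r)"
        proof (rule sum_mono)
          fix r assume "r \<in> K"
          then have "r \<in> \<rho> ` Y" "lev r = k" using K(1) unfolding Z_def by auto
          then show "n \<le> 2 ^ (k + 1) * w r" using lev_ub[of r] by simp
        qed
        also have "\<dots> = 2 ^ (k + 1) * (\<Sum>r\<in>K. w r)" by (rule sum_distrib_left[symmetric])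
        also have "\<dots> \<le> 2 ^ (k + 1) * n"
          using wsum[of K] K unfolding Z_def by (intro mult_le_mono2) blast
        finally have "card K * n \<le> 2 ^ (k + 1) * n" .
        moreover have "0 < n"
          using omega_pos[OF fin] 3 unfolding n_def by fastforce
        ultimately show ?thesis using K(3) by simp
      qed
      then have "2 ^ c * omega Z ^ b \<le> 2 ^ c * (2 ^ (k + 1)) ^ b"
        by (intro mult_le_mono2 power_mono) auto
      moreover have "colourable Z (2 ^ c * omega Z ^ b)"
      proof -
        have "Z \<subseteq> \<rho> ` Y" unfolding Z_def by blast
        then show ?thesis using less.prems(2)[OF RY R] unfolding well_coloured_def by blast
      qed
      ultimately have "colourable Z (2 ^ c * (2 ^ (k + 1)) ^ b)" using colourable_mono by blast
      then obtain h where "\<And>r. r \<in> Z \<Longrightarrow> h r < 2 ^ c * (2 ^ (k + 1)) ^ b"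
        "\<And>r s. r \<in> Z \<Longrightarrow> s \<in> Z \<Longrightarrow> E r s \<Longrightarrow> h r \<noteq> (h s :: nat)"
        by (rule colourableE) blast
      then have "good k h" unfolding Z_def good_def by blast
      then show ?thesis by blast
    qed
    then obtain g where g: "\<And>k. good k (g k)" by metis
    have g_ub: "g (lev r) r < 2 ^ c * (2 ^ (lev r + 1)) ^ b" if "r \<in> \<rho> ` Y" for r
      using g[of "lev r"] that unfolding good_def by blast
    have g_edge: "g (lev r) r \<noteq> g (lev r) s" if "r \<in> \<rho> ` Y" "s \<in> \<rho> ` Y" "lev s = lev r" "E r s" for r s
      using g[of "lev r"] that unfolding good_def by blast
    define off where "off = palette_offset b c a n"
    define l where "l x = lev (\<rho> x)" for x
    \<comment> \<open>The block of a level starts after the blocks of all higher levels. Inside it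
      the pair of colours is written in base \<open>(n div 2 ^ l x) ^ a\<close>, which exceeds the
      second colour.\<close>
    define pos where
      "pos x = off (l x + 1) + (g (l x) (\<rho> x) * (n div 2 ^ l x) ^ a + f (\<rho> x) x)" for x
    \<comment> \<open>Light vertices count down from the top colour \<open>n ^ a - 1\<close>, which
      is position \<open>0\<close>; heavy ones keep their fibre colour at the bottom.\<close>
    define col where "col x = (if l x = 0 then f (\<rho> x) x else n ^ a - 1 - pos x)" for x
    have bound: "(n - w r) ^ a + off (lev r) \<le> n ^ a" if "r \<in> \<rho> ` Y" "lev r \<noteq> 0" for r
      unfolding off_def
      by (rule palette_bound[OF a]) (use lev_ub[OF that(1)] that(2) wn in \<open>auto intro: less_imp_le\<close>)
    have fx: "f (\<rho> x) x < w (\<rho> x) ^ a" if "x \<in> Y" for x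
      using f(1)[of x "\<rho> x"] that unfolding fibre_def by simp
    have fm: "f (\<rho> x) x < (n div 2 ^ l x) ^ a" if "x \<in> Y" "l x \<noteq> 0" for x
    proof -
      have "w (\<rho> x) \<le> n div 2 ^ l x"
        using lev_lb[of "\<rho> x"] that(2) unfolding l_def
        by (simp add: less_eq_div_iff_mult_less_eq mult.commute)
      then show ?thesis using fx[OF that(1)] by (meson less_le_trans power_mono zero_le)
    qed
    have pos_ub: "pos x < off (l x)" if "x \<in> Y" "l x \<noteq> 0" for x
    proof -
      \<comment> \<open>The sum defining the offset stops at \<open>n\<close>, so the level must be
        at most \<open>n\<close> for its block to occur.\<close>
      have "2 ^ l x \<le> 2 ^ l x * w (\<rho> x)" using w1[of "\<rho> x"] that(1) by simp
      then have "2 ^ l x \<le> n" using lev_lb[of "\<rho> x"] that(2) unfolding l_def by linarith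
      then have "l x \<le> n" using less_exp[of "l x"] by linarith
      have "g (l x) (\<rho> x) < 2 ^ c * (2 ^ (l x + 1)) ^ b" using g_ub[of "\<rho> x"] that(1) unfolding l_def by blast
      then have "Suc (g (l x) (\<rho> x)) * (n div 2 ^ l x) ^ a
          \<le> 2 ^ c * (2 ^ (l x + 1)) ^ b * (n div 2 ^ l x) ^ a"
        by (intro mult_le_mono1) simp
      then show ?thesis
        using fm[OF that] palette_offset_step[OF \<open>l x \<le> n\<close>, of b c a] unfolding pos_def off_def by simp
    qed
    have off_ub: "(n - w (\<rho> x)) ^ a + off (l x) \<le> n ^ a" if "x \<in> Y" "l x \<noteq> 0" for x
      using bound[of "\<rho> x"] that unfolding l_def by blast
    \<comment> \<open>An edge caps the heavy weight at \<open>n - w (\<rho> y)\<close>, so by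
      \<open>palette_bound\<close> the heavy colours stay below the block of
      \<open>y\<close>.\<close>
    have heavy_light: "col x < col y" if xy: "x \<in> Y" "y \<in> Y" "E (\<rho> x) (\<rho> y)" "l x = 0" "l y \<noteq> 0" for x y
    proof -
      have "w (\<rho> x) \<le> n - w (\<rho> y)" using wedge[of "\<rho> x" "\<rho> y"] xy by simp
      then have "w (\<rho> x) ^ a \<le> (n - w (\<rho> y)) ^ a" by (intro power_mono) auto
      then show ?thesis
        using fx[OF xy(1)] pos_ub[OF xy(2,5)] off_ub[OF xy(2,5)] xy(4,5) unfolding col_def by simp
    qed
    have light: "col x \<noteq> col y"
      if xy: "x \<in> Y" "y \<in> Y" "l x \<noteq> 0" "l y \<noteq> 0" "pos x \<noteq> pos y" for x y
      using pos_ub[OF xy(1,3)] pos_ub[OF xy(2,4)] off_ub[OF xy(1,3)] off_ub[OF xy(2,4)] xy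
      unfolding col_def by simp
    have lower: "pos y < pos x" if xy: "x \<in> Y" "y \<in> Y" "l x \<noteq> 0" "l y \<noteq> 0" "l x < l y" for x y
    proof -
      have "pos y < off (l y)" using pos_ub xy by blast
      also have "\<dots> \<le> off (l x + 1)"
        unfolding off_def by (rule palette_offset_antimono) (use xy in simp)
      also have "\<dots> \<le> pos x" unfolding pos_def by simp
      finally show ?thesis .
    qed
    show ?thesis
      unfolding n_def[symmetric]
    proof (rule colourableI[where c = col])
      fix x assume x: "x \<in> Y"
      show "col x < n ^ a"
      proof (cases "l x = 0")
        case True
        have "w (\<rho> x) ^ a \<le> n ^ a" using wn by (intro power_mono) auto
        then show ?thesis using fx[OF x] True unfolding col_def by simp
      next
        case False
        then show ?thesis using pos_ub[OF x False] off_ub[OF x False] unfolding col_def by simp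
      qed
    next
      fix x y assume x: "x \<in> Y" and y: "y \<in> Y" and xy: "E x y"
      show "col x \<noteq> col y"
      proof (cases "\<rho> x = \<rho> y")
        case True
        have "f (\<rho> x) x \<noteq> f (\<rho> x) y"
          using f(2)[of x "\<rho> x" y] x y xy True unfolding fibre_def by simp
        moreover from this have "pos x \<noteq> pos y" using True unfolding pos_def l_def by simp
        ultimately show ?thesis using light[OF x y] True unfolding col_def l_def by auto
      next
        case False
        then have E: "E (\<rho> x) (\<rho> y)" using quotient_edge[OF q x y] xy by blast
        have sumw: "w (\<rho> x) + w (\<rho> y) \<le> n" using wedge E x y by blast
        consider "l x = 0" "l y = 0" | "l x = 0" "l y \<noteq> 0" | "l x \<noteq> 0" "l y = 0"
          | "l x \<noteq> 0" "l y \<noteq> 0" "l x \<noteq> l y" | "l x \<noteq> 0" "l y \<noteq> 0" "l x = l y" by blast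
        then show ?thesis
        proof cases
          case 1
          then have "n < 2 * w (\<rho> x)" "n < 2 * w (\<rho> y)"
            using lev_ub[of "\<rho> x"] lev_ub[of "\<rho> y"] x y unfolding l_def by auto
          then show ?thesis using sumw by linarith
        next
          case 2
          then show ?thesis using heavy_light[OF x y E] by simp
        next
          case 3
          then show ?thesis using heavy_light[OF y x sym[OF E]] by simp
        next
          case 4
          then show ?thesis using light[OF x y] lower[OF x y] lower[OF y x] by fastforce
        next
          case 5
          \<comment> \<open>On a common level, division by the base \<open>m\<close> recovers the
            first colour, which differs for adjacent representatives.\<close>
          define m where "m = (n div 2 ^ l x) ^ a"
          have "g (l x) (\<rho> x) \<noteq> g (l x) (\<rho> y)"
            using g_edge[of "\<rho> x" "\<rho> y"] x y E 5(3) unfolding l_def by auto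
          moreover have "f (\<rho> x) x < m" "f (\<rho> y) y < m"
            using fm[OF x 5(1)] fm[OF y 5(2)] 5(3) unfolding m_def by auto
          moreover have "(u * m + v) div m = u" if "v < m" for u v using that by simp
          ultimately have "g (l x) (\<rho> x) * m + f (\<rho> x) x \<noteq> g (l x) (\<rho> y) * m + f (\<rho> y) y"
            by metis
          then have "pos x \<noteq> pos y" using 5(3) unfolding pos_def m_def by simp
          then show ?thesis using light[OF x y 5(1,2)] by blast
        qed
      qed
    qed
  qed
qed

section \<open>Splitting off a set that meets every maximum clique\<close>

lemma indecomposable_image:
  assumes P: "indecomposable P" and inj: "inj_on f P"
    and iso: "\<And>x y. x \<in> P \<Longrightarrow> y \<in> P \<Longrightarrow> E x y \<longleftrightarrow> E (f x) (f y)"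
  shows "indecomposable (f ` P)"
  unfolding indecomposable_def
proof (intro conjI allI impI)
  show "finite (f ` P)" using P indecomposable_finite by blast
  show "2 \<le> card (f ` P)" using P card_image[OF inj] indecomposable_card by simp
  fix X assume X: "homogeneous X (f ` P)"
  define X' where "X' = {x \<in> P. f x \<in> X}"
  have fX': "X = f ` X'" using X unfolding X'_def homogeneous_def by blast
  have "homogeneous X' P"
  proof (rule homogeneousI)
    fix u assume u: "u \<in> P" "u \<notin> X'"
    then have "f u \<in> f ` P - X" unfolding X'_def by blast
    then have "(\<forall>x\<in>X. E (f u) x) \<or> (\<forall>x\<in>X. \<not> E (f u) x)" using X unfolding homogeneous_def by blast
    then show "(\<forall>x\<in>X'. E u x) \<or> (\<forall>x\<in>X'. \<not> E u x)" using iso u unfolding X'_def by auto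
  qed (auto simp: X'_def)
  then have "card X' \<le> 1 \<or> X' = P" using P unfolding indecomposable_def by blast
  moreover have "card X \<le> card X'"
    unfolding fX' using P indecomposable_finite by (intro card_image_le) (auto simp: X'_def)
  ultimately show "card X \<le> 1 \<or> X = f ` P" using fX' by auto
qed

text \<open>Cliques of the image lift along \<open>f\<close>, so passing to the image does not raise
  the clique number.\<close>

lemma well_coloured_preimage:
  assumes "finite P" and good: "well_coloured c b (f ` P)" and inj: "inj_on f P"
    and iso: "\<And>x y. x \<in> P \<Longrightarrow> y \<in> P \<Longrightarrow> E x y \<longleftrightarrow> E (f x) (f y)"
  shows "well_coloured c b P"
  unfolding well_coloured_def
proof (intro allI impI)
  fix Z assume Z: "Z \<subseteq> P"
  have finZ: "finite Z" using Z assms(1) finite_subset by blast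
  have "omega (f ` Z) \<le> omega Z"
  proof -
    obtain K where K: "K \<subseteq> f ` Z" "pairwise E K" "card K = omega (f ` Z)"
      using omega_clique[of "f ` Z"] finZ by blast
    obtain L where L: "L \<subseteq> Z" "K = f ` L" using K(1) by (meson subset_imageE)
    have injL: "inj_on f L" using inj L Z by (meson inj_on_subset)
    have "pairwise E L"
      using K(2) L Z iso injL unfolding pairwise_def inj_on_def by (metis image_eqI subsetD)
    then show ?thesis using omega_ge[OF finZ L(1)] K(3) L(2) card_image[OF injL] by simp
  qed
  then have "2 ^ c * omega (f ` Z) ^ b \<le> 2 ^ c * omega Z ^ b"
    by (intro mult_le_mono2 power_mono) auto
  moreover have "colourable (f ` Z) (2 ^ c * omega (f ` Z) ^ b)"
    using good Z unfolding well_coloured_def by blast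
  ultimately have "colourable (f ` Z) (2 ^ c * omega Z ^ b)" using colourable_mono by blast
  then obtain h where h: "\<And>x. x \<in> f ` Z \<Longrightarrow> h x < 2 ^ c * omega Z ^ b"
    "\<And>x y. x \<in> f ` Z \<Longrightarrow> y \<in> f ` Z \<Longrightarrow> E x y \<Longrightarrow> h x \<noteq> (h y :: nat)"
    by (rule colourableE) blast
  show "colourable Z (2 ^ c * omega Z ^ b)"
    by (rule colourableI[where c = "h \<circ> f"]) (use h iso Z in \<open>auto simp: subset_iff\<close>)
qed

text \<open>\<open>A\<close> is built recursively: in an indecomposable quotient take the given
  \<open>v\<close>, and unite the sets obtained in the fibres over \<open>v\<close> and its
  non-neighbours. An indecomposable subset of \<open>A\<close> lies in one fibre or embeds into the
  quotient, and every maximum clique of \<open>Y\<close> meets \<open>A\<close>.\<close>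

lemma divisible:
  assumes "finite Y" "Y \<noteq> {}"
    and "\<And>R. R \<subseteq> Y \<Longrightarrow> indecomposable R \<Longrightarrow>
      \<exists>v\<in>R. \<forall>P. P \<subseteq> {u \<in> R. \<not> E v u} \<longrightarrow> indecomposable P \<longrightarrow> well_coloured c b P"
  shows "\<exists>A\<subseteq>Y. (\<forall>P. P \<subseteq> A \<longrightarrow> indecomposable P \<longrightarrow> well_coloured c b P) \<and> omega (Y - A) < omega Y"
  using assms
proof (induction "card Y" arbitrary: Y rule: less_induct)
  case less
  note fin = less.prems(1)
  show ?case
  proof (cases "2 \<le> card Y")
    case False
    have "\<not> indecomposable P" if "P \<subseteq> Y" for P
      using card_mono[OF fin that] indecomposable_card[of P] False by linarith
    moreover have "omega (Y - Y) < omega Y"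
      using omega_empty omega_pos[OF fin] less.prems(2) by fastforce
    ultimately show ?thesis by blast
  next
    case True
    obtain \<rho> where q: "quotient_map Y \<rho>" and R: "indecomposable (\<rho> ` Y)"
      using indecomposable_quotient[OF fin True] .
    have RY: "\<rho> ` Y \<subseteq> Y" using q unfolding quotient_map_def by blast
    obtain v where v: "v \<in> \<rho> ` Y" and
      good: "\<And>P. P \<subseteq> {u \<in> \<rho> ` Y. \<not> E v u} \<Longrightarrow> indecomposable P \<Longrightarrow> well_coloured c b P"
      using less.prems(3)[OF RY R] by blast
    define F where "F = fibre \<rho> Y"
    have finF: "finite (F r)" for r using fin unfolding F_def fibre_def by simp
    have FY: "F r \<subseteq> Y" for r unfolding F_def fibre_def by blast
    have "\<exists>A\<subseteq>F r. (\<forall>P. P \<subseteq> A \<longrightarrow> indecomposable P \<longrightarrow> well_coloured c b P) \<and>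
        omega (F r - A) < omega (F r)" if "r \<in> \<rho> ` Y" for r
    proof (rule less.hyps)
      show "card (F r) < card Y"
        unfolding F_def using fibre_smaller[OF fin q indecomposable_card[OF R]] .
      show "F r \<noteq> {}" unfolding F_def using quotient_rep(3)[OF q that] by blast
      show "\<exists>v\<in>S. \<forall>P. P \<subseteq> {u \<in> S. \<not> E v u} \<longrightarrow> indecomposable P \<longrightarrow> well_coloured c b P"
        if "S \<subseteq> F r" "indecomposable S" for S
        using less.prems(3) that FY by (meson subset_trans)
    qed (rule finF)
    then obtain B where B: "\<And>r. r \<in> \<rho> ` Y \<Longrightarrow> B r \<subseteq> F r"
      "\<And>r P. r \<in> \<rho> ` Y \<Longrightarrow> P \<subseteq> B r \<Longrightarrow> indecomposable P \<Longrightarrow> well_coloured c b P"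
      "\<And>r. r \<in> \<rho> ` Y \<Longrightarrow> omega (F r - B r) < omega (F r)"
      by metis
    define N where "N = {u \<in> \<rho> ` Y. \<not> E v u}"
    define A where "A = (\<Union>r\<in>N. B r)"
    have AY: "A \<subseteq> Y" using B(1) FY unfolding A_def N_def by blast
    have A: "\<rho> x \<in> N" "x \<in> B (\<rho> x)" if "x \<in> A" for x
    proof -
      obtain r where r: "r \<in> N" "x \<in> B r" using \<open>x \<in> A\<close> unfolding A_def by blast
      then have "\<rho> x = r" using B(1)[of r] unfolding N_def F_def fibre_def by blast
      with r show "\<rho> x \<in> N" "x \<in> B (\<rho> x)" by auto
    qed
    have "well_coloured c b P" if P: "P \<subseteq> A" "indecomposable P" for P
    proof (cases "inj_on \<rho> P")
      case True
      have iso: "E x y \<longleftrightarrow> E (\<rho> x) (\<rho> y)" if "x \<in> P" "y \<in> P" for x y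
      proof (cases "x = y")
        case False
        then have "\<rho> x \<noteq> \<rho> y" using True that unfolding inj_on_def by blast
        then show ?thesis using quotient_edge[OF q, of x y] that P(1) AY by blast
      qed (simp add: irrefl)
      have "\<rho> ` P \<subseteq> N" using P(1) A(1) by blast
      then have "well_coloured c b (\<rho> ` P)"
        using good indecomposable_image[OF P(2) True iso] unfolding N_def by blast
      then show ?thesis
        using well_coloured_preimage[OF indecomposable_finite[OF P(2)] _ True iso] by blast
    next
      case False
      \<comment> \<open>Two vertices of \<open>P\<close> share a fibre, whose trace on
        \<open>P\<close> is homogeneous and hence all of \<open>P\<close>.\<close>
      then obtain x y where xy: "x \<in> P" "y \<in> P" "x \<noteq> y" "\<rho> x = \<rho> y" unfolding inj_on_def by blast
      have "x \<in> F (\<rho> x)" "y \<in> F (\<rho> x)" using xy P(1) AY unfolding F_def fibre_def by auto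
      moreover have "homogeneous (P \<inter> F (\<rho> x)) P"
        unfolding F_def using fibre_homogeneous[OF q] P(1) AY by (meson subset_trans)
      ultimately have "P \<inter> F (\<rho> x) = P"
        using indecomposable_homogeneous[OF P(2)] xy by blast
      then have "P \<subseteq> B (\<rho> x)"
      proof (intro subsetI)
        fix z assume "z \<in> P"
        then have "\<rho> z = \<rho> x" using \<open>P \<inter> F (\<rho> x) = P\<close> unfolding F_def fibre_def by blast
        then show "z \<in> B (\<rho> x)" using A(2)[of z] P(1) \<open>z \<in> P\<close> by auto
      qed
      then show ?thesis using B(2)[of "\<rho> x" P] P xy AY by blast
    qed
    moreover have "omega (Y - A) < omega Y"
    proof (rule ccontr)
      assume neg: "\<not> ?thesis"
      have finYA: "finite (Y - A)" using fin by simp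
      obtain K where K: "K \<subseteq> Y - A" "pairwise E K" "card K = omega (Y - A)"
        using omega_clique[OF finYA] .
      have Kbig: "omega Y \<le> card K" using neg K(3) by simp
      have finK: "finite K" using K(1) fin by (meson finite_Diff finite_subset)
      have vY: "v \<in> Y" "\<rho> v = v" using quotient_rep[OF q v] by auto
      \<comment> \<open>Otherwise \<open>v\<close> is adjacent to all of \<open>K\<close> and
        enlarges a clique that is already maximum.\<close>
      have "\<exists>x\<in>K. \<rho> x \<in> N"
      proof (rule ccontr)
        assume n: "\<not> ?thesis"
        have vx: "E v x" if "x \<in> K" for x
        proof -
          have "\<rho> x \<in> \<rho> ` Y" "\<rho> x \<notin> N" "x \<in> Y" using n that K(1) by auto
          then have "E v (\<rho> x)" unfolding N_def by blast
          moreover from this have "\<rho> v \<noteq> \<rho> x" using vY irrefl by metis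
          ultimately show ?thesis using quotient_edge[OF q vY(1) \<open>x \<in> Y\<close>] vY(2) by simp
        qed
        have "card (insert v K) \<le> omega Y"
          using K vY by (intro omega_ge[OF fin] pairwise_insert_E vx) auto
        moreover have "v \<notin> K" using vx irrefl by blast
        ultimately show False using Kbig finK by simp
      qed
      then obtain x0 where x0: "x0 \<in> K" "\<rho> x0 \<in> N" by blast
      define r where "r = \<rho> x0"
      have r: "r \<in> N" "r \<in> \<rho> ` Y" using x0 K(1) unfolding r_def by auto
      obtain L where L: "L \<subseteq> F r" "pairwise E L" "card L = omega (F r)"
        using omega_clique[OF finF] .
      have "K \<inter> F r \<subseteq> F r - B r" using K(1) r(1) unfolding A_def by blast
      moreover have "pairwise E (K \<inter> F r)" using K(2) by (rule pairwise_subset) blast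
      ultimately have "card (K \<inter> F r) \<le> omega (F r - B r)" using omega_ge finF by (metis finite_Diff)
      then have less: "card (K \<inter> F r) < card L" using B(3)[OF r(2)] L(3) by simp
      \<comment> \<open>Exchange: a vertex of \<open>K\<close> outside the fibre sees
        \<open>x0\<close>, hence the whole fibre, so the part of \<open>K\<close> in the fibre can
        be replaced by the larger clique \<open>L\<close>.\<close>
      have KL: "E x y" if "x \<in> K - F r" "y \<in> L" for x y
      proof -
        have x: "x \<in> Y" "\<rho> x \<noteq> r" using that K(1) unfolding F_def fibre_def by auto
        have y: "y \<in> Y" "\<rho> y = r" using that L(1) unfolding F_def fibre_def by auto
        have "x \<in> K" "x \<noteq> x0" using that(1) x(2) unfolding r_def by auto
        then have "E x x0" using x0(1) K(2) unfolding pairwise_def by blast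
        moreover have "E x x0 \<longleftrightarrow> E (\<rho> x) r"
          using quotient_edge[OF q x(1), of x0] x(2) x0(1) K(1) unfolding r_def by blast
        moreover have "E x y \<longleftrightarrow> E (\<rho> x) r" using quotient_edge[OF q x(1) y(1)] x(2) y(2) by simp
        ultimately show ?thesis by blast
      qed
      have "pairwise E ((K - F r) \<union> L)"
        unfolding pairwise_def
      proof (intro ballI impI)
        fix x y assume "x \<in> K - F r \<union> L" "y \<in> K - F r \<union> L" "x \<noteq> y"
        then show "E x y" using KL[of x y] KL[of y x] sym[of y x] K(2) L(2) unfolding pairwise_def by blast
      qed
      then have "card ((K - F r) \<union> L) \<le> omega Y"
        using K(1) L(1) FY[of r] by (intro omega_ge[OF fin]) auto
      moreover have "card ((K - F r) \<union> L) = card (K - F r) + card L"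
        using finK L(1) finF finite_subset by (intro card_Un_disjoint) blast+
      moreover have "card K = card (K - F r) + card (K \<inter> F r)"
        using finK by (metis add.commute card_Int_Diff)
      ultimately show False using Kbig less by linarith
    qed
    ultimately show ?thesis using AY by blast
  qed
qed

text \<open>Induction on the clique number \<open>n\<close>: the part \<open>A\<close> costs
  \<open>n ^ a\<close> colours and the rest, of smaller clique number,
  \<open>(n - 1) * n ^ a\<close>.\<close>

lemma divisible_colourable:
  assumes "finite V" and a: "2 * b + c + 3 \<le> a"
    and R: "\<And>R. R \<subseteq> V \<Longrightarrow> indecomposable R \<Longrightarrow>
      \<exists>v\<in>R. \<forall>P. P \<subseteq> {u \<in> R. \<not> E v u} \<longrightarrow> indecomposable P \<longrightarrow> well_coloured c b P"
  shows "colourable V (omega V ^ (a + 1))"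
proof -
  have "colourable Y (omega Y ^ (a + 1))" if "Y \<subseteq> V" for Y
    using that
  proof (induction "omega Y" arbitrary: Y rule: less_induct)
    case less
    have fin: "finite Y" using less.prems assms(1) finite_subset by blast
    show ?case
    proof (cases "Y = {}")
      case True
      then show ?thesis by (simp add: colourable_def)
    next
      case False
      have "\<exists>A\<subseteq>Y. (\<forall>P. P \<subseteq> A \<longrightarrow> indecomposable P \<longrightarrow> well_coloured c b P) \<and>
          omega (Y - A) < omega Y"
        by (rule divisible[OF fin False]) (use R subset_trans[OF _ less.prems] in auto)
      then obtain A where A: "A \<subseteq> Y" "\<And>P. P \<subseteq> A \<Longrightarrow> indecomposable P \<Longrightarrow> well_coloured c b P"
        "omega (Y - A) < omega Y"
        by blast
      define n where "n = omega Y"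
      have n: "1 \<le> n" using A(3) unfolding n_def by simp
      have finA: "finite A" using A(1) fin finite_subset by blast
      have "colourable A (omega A ^ a)" by (rule substitution_colourable[OF finA a A(2)])
      moreover have "omega A ^ a \<le> n ^ a"
        unfolding n_def using omega_mono[OF fin A(1)] by (intro power_mono) auto
      ultimately have 1: "colourable A (n ^ a)" using colourable_mono by blast
      have "colourable (Y - A) (omega (Y - A) ^ (a + 1))"
        using less.hyps[OF A(3)] less.prems by blast
      moreover have "omega (Y - A) ^ (a + 1) \<le> (n - 1) * n ^ a"
      proof -
        have "omega (Y - A) \<le> n - 1" using A(3) unfolding n_def by simp
        moreover have "omega (Y - A) ^ a \<le> n ^ a"
          using A(3) unfolding n_def by (intro power_mono) auto
        ultimately show ?thesis by (simp add: mult_le_mono)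
      qed
      ultimately have "colourable (Y - A) ((n - 1) * n ^ a)" using colourable_mono by blast
      then have "colourable (A \<union> (Y - A)) (n ^ a + (n - 1) * n ^ a)" by (rule colourable_Un[OF 1])
      moreover have "n ^ a + (n - 1) * n ^ a = n ^ (a + 1)"
        using n by (cases n) auto
      moreover have "A \<union> (Y - A) = Y" using A(1) by blast
      ultimately show ?thesis unfolding n_def by simp
    qed
  qed
  then show ?thesis by blast
qed

subsection \<open>Distance levels\<close>

lemma distance_levels:
  assumes reach: "\<And>x. x \<in> U \<Longrightarrow> (g, x) \<in> {(a, b). a \<in> U \<and> b \<in> U \<and> E a b}\<^sup>*"
  obtains d :: "'a \<Rightarrow> nat" where
    "\<And>x. x \<in> U \<Longrightarrow> d x = 0 \<Longrightarrow> x = g"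
    "\<And>x n. x \<in> U \<Longrightarrow> d x = Suc n \<Longrightarrow> \<exists>y\<in>U. E y x \<and> d y = n"
    "\<And>x y. x \<in> U \<Longrightarrow> y \<in> U \<Longrightarrow> E x y \<Longrightarrow> d y \<le> Suc (d x)"
proof -
  define r where "r = {(a, b). a \<in> U \<and> b \<in> U \<and> E a b}"
  define d where "d x = (LEAST n. (g, x) \<in> r ^^ n)" for x
  have ex: "\<exists>n. (g, x) \<in> r ^^ n" if "x \<in> U" for x
    using reach[OF that] rtrancl_imp_relpow unfolding r_def by blast
  have dist: "(g, x) \<in> r ^^ d x" if "x \<in> U" for x
    using LeastI_ex[OF ex[OF that]] unfolding d_def .
  have least: "d x \<le> n" if "(g, x) \<in> r ^^ n" for x n
    unfolding d_def using that by (rule Least_le)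
  have step: "d y \<le> Suc (d x)" if "x \<in> U" "y \<in> U" "E x y" for x y
  proof (rule least)
    have "(x, y) \<in> r" using that unfolding r_def by blast
    with dist[OF that(1)] show "(g, y) \<in> r ^^ Suc (d x)" by (rule relpow_Suc_I)
  qed
  show thesis
  proof (rule that[of d])
    show "x = g" if "x \<in> U" "d x = 0" for x using dist[OF that(1)] that(2) by simp
    show "\<exists>y\<in>U. E y x \<and> d y = n" if x: "x \<in> U" "d x = Suc n" for x n
    proof -
      have "(g, x) \<in> r ^^ Suc n" using dist[OF x(1)] x(2) by simp
      then obtain y where y: "(g, y) \<in> r ^^ n" "(y, x) \<in> r" by (rule relpow_Suc_E)
      then have "y \<in> U" "E y x" unfolding r_def by auto
      moreover have "d y \<le> n" using least[OF y(1)] .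
      moreover have "Suc n \<le> Suc (d y)" using step[OF \<open>y \<in> U\<close> x(1) \<open>E y x\<close>] x(2) by simp
      ultimately show ?thesis by auto
    qed
  qed (rule step)
qed

text \<open>Edges stay in a level or join consecutive ones, so two disjoint palettes alternating
  with the parity of the level suffice.\<close>

lemma colourable_levels:
  assumes "\<And>i. colourable {x \<in> Z. d x = (i :: nat)} N"
    and step: "\<And>x y. x \<in> Z \<Longrightarrow> y \<in> Z \<Longrightarrow> E x y \<Longrightarrow> d y \<le> Suc (d x)"
  shows "colourable Z (2 * N)"
proof -
  define good where "good i f \<longleftrightarrow> (\<forall>x\<in>Z. d x = i \<longrightarrow> f x < N \<and>
    (\<forall>y\<in>Z. d y = i \<longrightarrow> E x y \<longrightarrow> f x \<noteq> (f y :: nat)))" for i f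
  have "\<exists>f. good i f" for i
    using assms(1)[of i] unfolding good_def by (rule colourableE) blast
  then obtain f where f: "\<And>i. good i (f i)" by metis
  have f_ub: "f (d x) x < N" if "x \<in> Z" for x
    using f[of "d x"] that unfolding good_def by blast
  have f_edge: "f (d x) x \<noteq> f (d x) y" if "x \<in> Z" "y \<in> Z" "d x = d y" "E x y" for x y
    using f[of "d x"] that unfolding good_def by auto
  define c where "c x = (if even (d x) then f (d x) x else N + f (d x) x)" for x
  show ?thesis
  proof (rule colourableI[where c = c])
    show "c x < 2 * N" if "x \<in> Z" for x using f_ub[OF that] unfolding c_def by auto
    show "c x \<noteq> c y" if xy: "x \<in> Z" "y \<in> Z" "E x y" for x y
    proof (cases "d x = d y")
      case True
      then show ?thesis using f_edge[OF xy(1,2) _ xy(3)] unfolding c_def by auto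
    next
      case False
      then have "d x = Suc (d y) \<or> d y = Suc (d x)"
        using step[OF xy] step[OF xy(2,1) sym[OF xy(3)]] by linarith
      then show ?thesis using f_ub[OF xy(1)] f_ub[OF xy(2)] unfolding c_def by auto
    qed
  qed
qed

section \<open>Indecomposable sets inside one level, and the non-neighbourhood of a vertex\<close>

lemma well_coloured_if_colourable:
  assumes "finite P" "\<And>Z. Z \<subseteq> P \<Longrightarrow> Z \<noteq> {} \<Longrightarrow> colourable Z (2 ^ c * omega Z ^ b)"
  shows "well_coloured c b P"
  unfolding well_coloured_def
proof (intro allI impI)
  fix Z assume "Z \<subseteq> P"
  then show "colourable Z (2 ^ c * omega Z ^ b)"
    using assms(2) by (cases "Z = {}") (auto simp: colourable_def)
qed

lemma well_coloured_constant:
  assumes "finite P" "colourable P k" "k \<le> 2 ^ c"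
  shows "well_coloured c b P"
proof (rule well_coloured_if_colourable)
  fix Z assume Z: "Z \<subseteq> P" "Z \<noteq> {}"
  then have "1 \<le> omega Z" using omega_pos assms(1) finite_subset by blast
  then have "k * 1 \<le> 2 ^ c * omega Z ^ b" by (intro mult_le_mono assms) auto
  then show "colourable Z (2 ^ c * omega Z ^ b)" using colourable_mono[OF assms(2) Z(1)] by simp
qed (rule assms)

lemma well_coloured_split:
  assumes "finite P" and S: "\<And>x y. x \<in> S \<Longrightarrow> y \<in> S \<Longrightarrow> \<not> E x y" and K: "pairwise E (P - S)"
    and "1 \<le> c"
  shows "well_coloured c 1 P"
proof (rule well_coloured_if_colourable)
  fix Z assume Z: "Z \<subseteq> P" "Z \<noteq> {}"
  have finZ: "finite Z" using Z(1) assms(1) finite_subset by blast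
  then have 1: "1 \<le> omega Z" using omega_pos Z(2) by blast
  have "colourable (Z \<inter> S) 1" by (rule colourable_stable) (use S in blast)
  moreover have "pairwise E (Z - S)" using K by (rule pairwise_subset) (use Z in blast)
  then have "card (Z - S) \<le> omega Z" by (intro omega_ge[OF finZ]) auto
  then have "colourable (Z - S) (omega Z)"
    using colourable_card[of "Z - S"] finZ colourable_mono by blast
  ultimately have "colourable (Z \<inter> S \<union> (Z - S)) (1 + omega Z)" by (rule colourable_Un)
  moreover have "1 + omega Z \<le> 2 ^ c * omega Z ^ 1"
  proof -
    have "(2::nat) ^ 1 \<le> 2 ^ c" using \<open>1 \<le> c\<close> by (rule power_increasing) simp
    then have "2 * omega Z \<le> 2 ^ c * omega Z" by (intro mult_le_mono1) simp
    moreover have "1 + omega Z \<le> 2 * omega Z" using 1 by simp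
    ultimately show ?thesis unfolding power_one_right by (rule order_trans[rotated])
  qed
  moreover have "Z \<inter> S \<union> (Z - S) = Z" by blast
  ultimately show "colourable Z (2 ^ c * omega Z ^ 1)" using colourable_mono by (metis subset_refl)
qed (rule assms)

definition no_triangle :: "'a set \<Rightarrow> bool" where
  "no_triangle T \<longleftrightarrow> \<not> (\<exists>x\<in>T. \<exists>y\<in>T. \<exists>z\<in>T. E x y \<and> E y z \<and> E x z)"

text \<open>A triangle \<open>xyz\<close> in a level forces its parents to form a triangle, each parent seeing just one
  vertex of \<open>xyz\<close>; ancestors of the parents then complete a bull.\<close>

lemma level_no_triangle:
  assumes bf: "no_bull U" and K: "indecomposable K" "K \<subseteq> U"
    and level: "\<And>x. x \<in> K \<Longrightarrow> d x = Suc (Suc (Suc i))"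
    and parent: "\<And>x n. x \<in> U \<Longrightarrow> d x = Suc n \<Longrightarrow> \<exists>y\<in>U. E y x \<and> d y = n"
    and step: "\<And>x y. x \<in> U \<Longrightarrow> y \<in> U \<Longrightarrow> E x y \<Longrightarrow> d y \<le> Suc (d x)"
    and no_centre: "\<And>q. q \<in> U \<Longrightarrow> q \<notin> K \<Longrightarrow> \<exists>x\<in>K. \<not> E q x"
  shows "no_triangle K"
  unfolding no_triangle_def
proof (intro notI, elim bexE conjE)
  fix x y z assume K3: "x \<in> K" "y \<in> K" "z \<in> K" and tri: "E x y" "E y z" "E x z"
  have far: "\<not> E u w" "\<not> E w u" if "u \<in> U" "w \<in> U" "d u + 2 \<le> d w" for u w
    using step[OF that(1,2)] that(3) sym by fastforce+
  have xyz: "x \<in> U" "y \<in> U" "z \<in> U" "d x = Suc (Suc (Suc i))" "d y = Suc (Suc (Suc i))"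
    "d z = Suc (Suc (Suc i))"
    using K3 K(2) level by auto
  \<comment> \<open>A parent \<open>g\<close> of \<open>q\<close> is two levels away from
    \<open>K\<close>, hence anticomplete to it, so the neighbourhood of \<open>q\<close> in
    \<open>K\<close> is stable.\<close>
  have own: "\<not> E q b" if q: "q \<in> U" "d q = Suc (Suc i)" and ab: "a \<in> K" "E q a" "b \<in> K" "E a b" for q a b
  proof
    assume "E q b"
    obtain g where g: "g \<in> U" "E g q" "d g = Suc i" using parent[OF q] by blast
    have "q \<notin> K" using level q(2) by fastforce
    then have "mixed_on q K" using no_centre q(1) ab unfolding mixed_on_def by blast
    moreover have "\<not> E g w" if "w \<in> K" for w
      using far(1)[of g w] g level[OF that] K(2) that by auto
    ultimately have "\<not> E a b"
      using neighbourhood_stable[OF K(1) bf K(2) q(1) g(1)] g(2) ab \<open>E q b\<close> by blast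
    then show False using ab by blast
  qed
  obtain p where p: "p \<in> U" "E p x" "d p = Suc (Suc i)" using parent[OF xyz(1,4)] by blast
  obtain q where q: "q \<in> U" "E q y" "d q = Suc (Suc i)" using parent[OF xyz(2,5)] by blast
  obtain r where r: "r \<in> U" "E r z" "d r = Suc (Suc i)" using parent[OF xyz(3,6)] by blast
  have priv: "\<not> E p y" "\<not> E p z" "\<not> E q x" "\<not> E q z" "\<not> E r x" "\<not> E r y"
    using own[OF p(1,3) K3(1) p(2)] own[OF q(1,3) K3(2) q(2)] own[OF r(1,3) K3(3) r(2)]
      K3 tri sym by blast+
  \<comment> \<open>A missing edge \<open>p' q'\<close> leaves a path \<open>p' x' y' q'\<close>
    with \<open>z'\<close> adjacent to its middle.\<close>
  have join: "E p' q'" if "p' \<in> U" "q' \<in> U" "x' \<in> U" "y' \<in> U" "z' \<in> U" "E p' x'" "E q' y'"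
    "E x' y'" "E z' x'" "E z' y'" "\<not> E p' y'" "\<not> E p' z'" "\<not> E q' x'" "\<not> E q' z'" for p' q' x' y' z'
  proof (rule ccontr)
    assume "\<not> E p' q'"
    then show False
      by (intro no_bullD[OF bf, of p' x' y' q' z']) (use that sym in \<open>blast+\<close>)
  qed
  have pq: "E p q" by (rule join[of p q x y z]) (use p q xyz priv tri sym in \<open>blast+\<close>)
  have pr: "E p r" by (rule join[of p r x z y]) (use p r xyz priv tri sym in \<open>blast+\<close>)
  have qr: "E q r" by (rule join[of q r y z x]) (use q r xyz priv tri sym in \<open>blast+\<close>)
  \<comment> \<open>Level \<open>i + 3\<close> leaves room for two further generations,
    \<open>g\<close> above \<open>p\<close> and \<open>h\<close> above \<open>g\<close>. If
    \<open>g\<close> saw another parent \<open>q'\<close>, then \<open>h g p x\<close> with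
    \<open>q'\<close> would be a bull.\<close>
  obtain g where g: "g \<in> U" "E g p" "d g = Suc i" using parent[OF p(1,3)] by blast
  obtain h where h: "h \<in> U" "E h g" "d h = i" using parent[OF g(1,3)] by blast
  have fars: "\<not> E h p" "\<not> E h q" "\<not> E h r" "\<not> E h x" "\<not> E g x" "\<not> E g y"
    by (rule far(1); use g h p q r xyz in simp)+
  have gn: "\<not> E g q'" if "q' \<in> U" "E p q'" "\<not> E q' x" "\<not> E h q'" for q'
  proof
    assume "E g q'"
    then show False
      by (intro no_bullD[OF bf, of h g p x q'])
        (use that h g p xyz fars sym in \<open>blast+\<close>)
  qed
  \<comment> \<open>Among the three parents \<open>g\<close> sees \<open>p\<close> only, so
    \<open>g p q y\<close> is a path and \<open>r\<close> sees its middle.\<close>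
  have "\<not> E g q" "\<not> E g r" using gn q(1) r(1) pq pr priv fars by blast+
  then show False
    by (intro no_bullD[OF bf, of g p q y r])
      (use g p q r xyz pq pr qr priv fars sym in \<open>blast+\<close>)
qed

text \<open>In the levels from \<open>g\<close>, level one is just \<open>p\<close> and level two is
  stable. Later pieces fall under \<open>level_no_triangle\<close> or, if some vertex is complete to
  them, under the split lemma with \<open>v\<close> as the anticomplete vertex. The factor
  \<open>2 ^ 1\<close> pays for the parity of the levels.\<close>

lemma nonneighbourhood_well_coloured:
  assumes R: "indecomposable R" and bf: "no_bull R"
    and t: "\<And>T. T \<subseteq> R \<Longrightarrow> no_triangle T \<Longrightarrow> colourable T t" and L: "t \<le> 2 ^ L" "1 \<le> L"
    and v: "v \<in> R" and P: "P \<subseteq> {u \<in> R. \<not> E v u}" "indecomposable P"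
  shows "well_coloured 1 (L + 5) P"
proof (cases "3 \<le> card P")
  case False
  have finP: "finite P" by (rule indecomposable_finite[OF P(2)])
  show ?thesis
    by (rule well_coloured_constant[OF finP colourable_card[OF finP]]) (use False in simp)
next
  case True
  have finP: "finite P" by (rule indecomposable_finite[OF P(2)])
  have PR: "P \<subseteq> R" and vP: "\<And>x. x \<in> P \<Longrightarrow> \<not> E v x" using P(1) by auto
  have con: "connected_set P" using indecomposable_connected[OF P(2) True] .
  have "v \<notin> P"
  proof
    assume "v \<in> P"
    moreover have "{v} \<noteq> P" using True by auto
    ultimately have "\<exists>y\<in>P - {v}. E v y" using con unfolding connected_set_def by blast
    then show False using vP by blast
  qed
  have "2 \<le> card P" using True by simp
  obtain p g where pg: "p \<in> R - P" "g \<in> R - P" "mixed_on p P" "E g p" "\<forall>x\<in>P. \<not> E g x"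
    using anchored_mixed_vertex[OF R bf PR con \<open>2 \<le> card P\<close> v \<open>v \<notin> P\<close> vP] .
  define U where "U = insert g (insert p P)"
  have UR: "U \<subseteq> R" using pg PR unfolding U_def by auto
  have bfU: "no_bull U" using bf UR unfolding no_bull_def by (meson subset_trans)
  define rel where "rel = {(a, b). a \<in> U \<and> b \<in> U \<and> E a b}"
  have reach: "(g, x) \<in> rel\<^sup>*" if "x \<in> U" for x
  proof -
    define X where "X = {x \<in> P. (g, x) \<in> rel\<^sup>*}"
    have grow: "(g, y) \<in> rel\<^sup>*" if "(g, x) \<in> rel\<^sup>*" "x \<in> U" "y \<in> U" "E x y" for x y
      using that(1) by (rule rtrancl_into_rtrancl) (use that in \<open>simp add: rel_def\<close>)
    have p: "(g, p) \<in> rel\<^sup>*" using grow[of g p] pg(4) unfolding U_def by simp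
    obtain s where s: "s \<in> P" "E p s" using pg(3) unfolding mixed_on_def by blast
    have "s \<in> X" using grow[OF p, of s] s unfolding X_def U_def by simp
    have "X = P"
    proof (rule ccontr)
      assume "X \<noteq> P"
      moreover have "X \<subseteq> P" "X \<noteq> {}" using \<open>s \<in> X\<close> unfolding X_def by auto
      ultimately obtain x y where xy: "x \<in> X" "y \<in> P - X" "E x y"
        using con unfolding connected_set_def by meson
      then have "(g, y) \<in> rel\<^sup>*" using grow[of x y] unfolding X_def U_def by simp
      then show False using xy unfolding X_def by simp
    qed
    then show ?thesis using that p unfolding U_def X_def by auto
  qed
  obtain d :: "'a \<Rightarrow> nat" where d0: "\<And>x. x \<in> U \<Longrightarrow> d x = 0 \<Longrightarrow> x = g"
    and parent: "\<And>x n. x \<in> U \<Longrightarrow> d x = Suc n \<Longrightarrow> \<exists>y\<in>U. E y x \<and> d y = n"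
    and step: "\<And>x y. x \<in> U \<Longrightarrow> y \<in> U \<Longrightarrow> E x y \<Longrightarrow> d y \<le> Suc (d x)"
    using distance_levels[OF reach[unfolded rel_def]] by blast
  \<comment> \<open>\<open>g\<close> is anticomplete to \<open>P\<close>, so \<open>p\<close> is its
    only neighbour in \<open>U\<close>.\<close>
  have d1: "x = p" if "x \<in> U" "d x = 1" for x
  proof -
    obtain y where "y \<in> U" "E y x" "d y = 0" using parent[of x 0] \<open>x \<in> U\<close> \<open>d x = 1\<close> by auto
    then have "E g x" using d0 by blast
    then show ?thesis using that(1) pg(5) irrefl unfolding U_def by blast
  qed
  have d2: "E p x" if "x \<in> U" "d x = 2" for x
  proof -
    obtain y where "y \<in> U" "E y x" "d y = 1" using parent[of x 1] \<open>x \<in> U\<close> \<open>d x = 2\<close> by auto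
    then show ?thesis using d1 by blast
  qed
  have level: "well_coloured L 1 K" if K: "K \<subseteq> {x \<in> P. d x = i}" "indecomposable K" for K i
  proof -
    have finK: "finite K" by (rule indecomposable_finite[OF K(2)])
    have KP: "K \<subseteq> P" "K \<subseteq> U" "K \<subseteq> R" using K(1) PR unfolding U_def by auto
    have two: "2 \<le> (2::nat) ^ L" using L(2) power_increasing[of 1 L "2::nat"] by simp
    have triangle_free: ?thesis if "no_triangle K"
      using well_coloured_constant[OF finK t[OF KP(3) that] L(1)] .
    obtain k where k: "k \<in> K" using indecomposable_card[OF K(2)] by force
    \<comment> \<open>The complete vertex may lie anywhere in \<open>R\<close>, as the split lemma
      works in \<open>R\<close>; its absence is needed inside \<open>U\<close>, where the levels
      live.\<close>
    consider "card K \<le> 2" | "3 \<le> card K" "i \<le> 2"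
      | q where "3 \<le> card K" "q \<in> R" "q \<notin> K" "\<And>x. x \<in> K \<Longrightarrow> E q x"
      | j where "i = Suc (Suc (Suc j))" "\<And>q. q \<in> U \<Longrightarrow> q \<notin> K \<Longrightarrow> \<exists>x\<in>K. \<not> E q x"
    proof -
      have i: "i \<le> 2 \<or> (\<exists>j. i = Suc (Suc (Suc j)))" by presburger
      show thesis
      proof (cases "card K \<le> 2 \<or> i \<le> 2 \<or> (\<exists>q. q \<in> R \<and> q \<notin> K \<and> (\<forall>x\<in>K. E q x))")
        case True
        moreover have "card K \<le> 2 \<or> 3 \<le> card K" by linarith
        ultimately show thesis using that(1-3) by blast
      next
        case False
        then obtain j where "i = Suc (Suc (Suc j))" using i by blast
        moreover have "\<exists>x\<in>K. \<not> E q x" if "q \<in> U" "q \<notin> K" for q using False that UR by blast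
        ultimately show thesis using that(4) by blast
      qed
    qed
    then show ?thesis
    proof cases
      case 1
      then show ?thesis
        by (intro well_coloured_constant[OF finK colourable_card[OF finK]]) (use two in linarith)
    next
      case 2
      have "E p x" if "x \<in> K" for x
      proof -
        have x: "x \<in> U" "x \<in> P" "d x = i" using that K(1) unfolding U_def by auto
        have "d x \<noteq> 0" "d x \<noteq> 1" using d0[OF x(1)] d1[OF x(1)] x(2) pg by auto
        then have "d x = 2" using 2(2) x(3) by linarith
        then show ?thesis using d2[OF x(1)] by blast
      qed
      then have "\<not> E x y" if "x \<in> K" "y \<in> K" for x y
        using neighbourhood_stable[OF P(2) bf PR, of p g x y] pg KP that by blast
      then show ?thesis by (intro triangle_free) (auto simp: no_triangle_def)
    next
      case 3
      have "v \<notin> K" "\<And>x. x \<in> K \<Longrightarrow> \<not> E v x" using \<open>v \<notin> P\<close> vP KP by auto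
      then obtain S where S: "S \<subseteq> K" "\<And>x y. x \<in> S \<Longrightarrow> y \<in> S \<Longrightarrow> \<not> E x y" "pairwise E (K - S)"
        using split_between_centre_and_anticentre[OF R bf KP(3) K(2) 3 v] by metis
      show ?thesis using well_coloured_split[OF finK S(2,3) L(2)] by blast
    next
      case 4
      have "no_triangle K"
        by (rule level_no_triangle[OF bfU K(2) KP(2) _ parent step 4(2)]) (use K(1) 4(1) in auto)
      then show ?thesis by (rule triangle_free)
    qed
  qed
  show ?thesis
  proof (rule well_coloured_if_colourable[OF finP])
    fix Z assume Z: "Z \<subseteq> P" "Z \<noteq> {}"
    have finZ: "finite Z" using Z(1) finP finite_subset by blast
    have "colourable Z (2 * omega Z ^ (L + 5))"
    proof (rule colourable_levels)
      fix i
      let ?Z = "{x \<in> Z. d x = i}"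
      have level_Z: "well_coloured L 1 K" if "K \<subseteq> ?Z" "indecomposable K" for K
        using level[of K i] that Z(1) by blast
      \<comment> \<open>The exponent is \<open>2 * b + c + 3\<close> for \<open>b = 1\<close> and
        \<open>c = L\<close>.\<close>
      have "colourable ?Z (omega ?Z ^ (L + 5))"
        by (rule substitution_colourable[where b = 1 and c = L])
          (use finZ level_Z in auto)
      moreover have "omega ?Z ^ (L + 5) \<le> omega Z ^ (L + 5)"
        by (intro power_mono omega_mono finZ) auto
      ultimately show "colourable ?Z (omega Z ^ (L + 5))" using colourable_mono by blast
    next
      show "d y \<le> Suc (d x)" if "x \<in> Z" "y \<in> Z" "E x y" for x y
        using step that Z(1) unfolding U_def by blast
    qed
    then show "colourable Z (2 ^ 1 * omega Z ^ (L + 5))" by simp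
  qed
qed

lemma no_bull_colourable:
  assumes "finite V" and bf: "no_bull V"
    and t: "\<And>T. T \<subseteq> V \<Longrightarrow> no_triangle T \<Longrightarrow> colourable T t" and L: "t \<le> 2 ^ L" "1 \<le> L"
  shows "colourable V (omega V ^ (2 * L + 15))"
proof -
  \<comment> \<open>\<open>2 * L + 14\<close> is \<open>2 * b + c + 3\<close> for
    \<open>b = L + 5\<close> and \<open>c = 1\<close>; the last \<open>1\<close> is the cost of
    splitting.\<close>
  have exponent: "2 * L + 15 = 2 * L + 14 + 1" by simp
  show ?thesis
    unfolding exponent
  proof (rule divisible_colourable[where b = "L + 5" and c = 1])
    fix R assume R: "R \<subseteq> V" "indecomposable R"
    obtain v where v: "v \<in> R" using indecomposable_card[OF R(2)] by force
    have "no_bull R" using bf R(1) unfolding no_bull_def by (meson subset_trans)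
    then have "well_coloured 1 (L + 5) P" if "P \<subseteq> {u \<in> R. \<not> E v u}" "indecomposable P" for P
      using nonneighbourhood_well_coloured[OF R(2) _ _ L v that] t R(1) by (meson subset_trans)
    then show "\<exists>v\<in>R. \<forall>P. P \<subseteq> {u \<in> R. \<not> E v u} \<longrightarrow> indecomposable P \<longrightarrow> well_coloured 1 (L + 5) P"
      using v by blast
  qed (use assms in auto)
qed

end

subsection \<open>Graphs as symmetric digraphs\<close>

context graph
begin

lemma adjacency_dominates: "adjacency (\<lambda>u v. u \<rightarrow>\<^bsub>G\<^esub> v)"
proof
  show "x \<rightarrow>\<^bsub>G\<^esub> y \<Longrightarrow> y \<rightarrow>\<^bsub>G\<^esub> x" for x y by (rule arcs_ends_symmetric[OF sym_arcs])
  show "\<not> x \<rightarrow>\<^bsub>G\<^esub> x" for x using adj_not_same by blast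
qed

sublocale adj: adjacency "\<lambda>u v. u \<rightarrow>\<^bsub>G\<^esub> v" by (rule adjacency_dominates)

lemma arcs_ends_induce: "u \<rightarrow>\<^bsub>G \<restriction> X\<^esub> v \<longleftrightarrow> u \<rightarrow>\<^bsub>G\<^esub> v \<and> u \<in> X \<and> v \<in> X"
  unfolding arcs_ends_conv by auto

lemma clique_number_eq_omega: "clique_number G = adj.omega (verts G)"
  unfolding clique_number_def clique_def adj.omega_def ..

lemma chromatic_number_le:
  assumes "adj.colourable (verts G) k"
  shows "chromatic_number G \<le> k"
  unfolding chromatic_number_def
proof (rule Least_le)
  obtain c where c: "\<And>x. x \<in> verts G \<Longrightarrow> c x < k"
    "\<And>x y. x \<in> verts G \<Longrightarrow> y \<in> verts G \<Longrightarrow> x \<rightarrow>\<^bsub>G\<^esub> y \<Longrightarrow> c x \<noteq> (c y :: nat)"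
    by (rule adj.colourableE[OF assms]) blast
  then have "proper_colouring G k c"
    unfolding proper_colouring_def by (auto dest: adj_in_verts)
  then show "\<exists>c. proper_colouring G k c" by blast
qed

lemma colourable_if_chromatic_number_le:
  assumes "finite X" "chromatic_number (G \<restriction> X) \<le> k"
  shows "adj.colourable X k"
proof -
  have eq: "(\<exists>c. proper_colouring (G \<restriction> X) l c) \<longleftrightarrow> adj.colourable X l" for l
    unfolding proper_colouring_def adj.colourable_def arcs_ends_induce induce_subgraph_verts by blast
  have "adj.colourable X (chromatic_number (G \<restriction> X))"
    unfolding chromatic_number_def eq by (rule LeastI, rule adj.colourable_card[OF assms(1)])
  then show ?thesis using adj.colourable_mono assms(2) by blast
qed

lemma triangle_free_if_no_triangle:
  assumes "adj.no_triangle T"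
  shows "triangle_free (G \<restriction> T)"
  unfolding triangle_free_def
proof (intro notI, elim exE conjE)
  fix H assume H: "induced_subgraph H (G \<restriction> T)" "K\<^bsub>3\<^esub> H"
  from H(2) have "card (verts H) = 3" and ends: "arcs_ends H = {(u, v). (u, v) \<in> verts H \<times> verts H \<and> u \<noteq> v}"
    unfolding complete_digraph_def by auto
  then obtain x y z where xyz: "verts H = {x, y, z}" "x \<noteq> y" "y \<noteq> z" "x \<noteq> z"
    by (auto simp: card_3_iff)
  have sub: "u \<rightarrow>\<^bsub>G\<^esub> v \<and> u \<in> T \<and> v \<in> T" if "u \<rightarrow>\<^bsub>H\<^esub> v" for u v
  proof -
    have "arcs_ends H \<subseteq> arcs_ends (G \<restriction> T)"
      using H(1) by (intro arcs_ends_mono) auto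
    then show ?thesis using that arcs_ends_induce by blast
  qed
  have "x \<rightarrow>\<^bsub>H\<^esub> y" "y \<rightarrow>\<^bsub>H\<^esub> z" "x \<rightarrow>\<^bsub>H\<^esub> z" unfolding ends using xyz by auto
  then show False using sub assms unfolding adj.no_triangle_def by blast
qed

text \<open>The isomorphism is written down explicitly. The arcs of \<open>with_proj bull\<close>
  are pairs, so each arc goes to the pair of labels of its ends, injectively because there are no
  parallel arcs.\<close>

lemma no_bull_if_bull_free:
  assumes "bull_free G"
  shows "adj.no_bull (verts G)"
  unfolding adj.no_bull_def
proof (intro notI, elim exE conjE)
  fix a b c d e
  assume V: "{a, b, c, d, e} \<subseteq> verts G"
    and ed: "a \<rightarrow>\<^bsub>G\<^esub> b" "b \<rightarrow>\<^bsub>G\<^esub> c" "c \<rightarrow>\<^bsub>G\<^esub> d" "e \<rightarrow>\<^bsub>G\<^esub> b" "e \<rightarrow>\<^bsub>G\<^esub> c"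
    and non: "\<not> a \<rightarrow>\<^bsub>G\<^esub> c" "\<not> a \<rightarrow>\<^bsub>G\<^esub> d" "\<not> b \<rightarrow>\<^bsub>G\<^esub> d" "\<not> a \<rightarrow>\<^bsub>G\<^esub> e" "\<not> d \<rightarrow>\<^bsub>G\<^esub> e"
  define X where "X = {a, b, c, d, e}"
  have dist: "a \<noteq> b" "a \<noteq> c" "a \<noteq> d" "a \<noteq> e" "b \<noteq> c" "b \<noteq> d" "b \<noteq> e" "c \<noteq> d" "c \<noteq> e" "d \<noteq> e"
    using ed non adj.irrefl adj.sym by blast+
  define f where "f x = (if x = a then 0 else if x = b then 1 else if x = c then 2
      else if x = d then 3 else (4::nat))" for x
  define hom where "hom = \<lparr> iso_verts = f, iso_arcs = (\<lambda>x. (f (tail G x), f (head G x))),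
      iso_head = snd, iso_tail = fst \<rparr>"
  have f: "f a = 0" "f b = 1" "f c = 2" "f d = 3" "f e = 4" using dist unfolding f_def by auto
  have inj: "inj_on f X" unfolding X_def inj_on_def using f by auto
  have non': "\<not> c \<rightarrow>\<^bsub>G\<^esub> a" "\<not> d \<rightarrow>\<^bsub>G\<^esub> a" "\<not> d \<rightarrow>\<^bsub>G\<^esub> b" "\<not> e \<rightarrow>\<^bsub>G\<^esub> a" "\<not> e \<rightarrow>\<^bsub>G\<^esub> d"
    using non adj.sym by blast+
  have ed': "b \<rightarrow>\<^bsub>G\<^esub> a" "c \<rightarrow>\<^bsub>G\<^esub> b" "d \<rightarrow>\<^bsub>G\<^esub> c" "b \<rightarrow>\<^bsub>G\<^esub> e" "c \<rightarrow>\<^bsub>G\<^esub> e"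
    using ed adj.sym by blast+
  have ends: "arcs_ends G \<inter> X \<times> X = symcl {(a, b), (b, c), (c, d), (e, b), (e, c)}"
  proof (rule equalityI)
    show "symcl {(a, b), (b, c), (c, d), (e, b), (e, c)} \<subseteq> arcs_ends G \<inter> X \<times> X"
      using ed ed' unfolding X_def symcl_def by simp
    show "arcs_ends G \<inter> X \<times> X \<subseteq> symcl {(a, b), (b, c), (c, d), (e, b), (e, c)}"
    proof
      fix p assume "p \<in> arcs_ends G \<inter> X \<times> X"
      then obtain u v where p: "p = (u, v)" "u \<rightarrow>\<^bsub>G\<^esub> v" "u \<in> X" "v \<in> X" by auto
      have "u = a \<or> u = b \<or> u = c \<or> u = d \<or> u = e" "v = a \<or> v = b \<or> v = c \<or> v = d \<or> v = e"
        using p(3,4) unfolding X_def by simp_all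
      then show "p \<in> symcl {(a, b), (b, c), (c, d), (e, b), (e, c)}"
        unfolding p(1) symcl_def using p(2) non non' adj.irrefl by (elim disjE) simp_all
    qed
  qed
  have "pre_digraph.digraph_isomorphism (G \<restriction> X) hom"
    unfolding pre_digraph.digraph_isomorphism_def hom_def
  proof (intro conjI)
    show "wf_digraph (G \<restriction> X)" by auto
    show "inj_on (iso_verts \<lparr>iso_verts = f, iso_arcs = \<lambda>x. (f (tail G x), f (head G x)),
        iso_head = snd, iso_tail = fst\<rparr>) (verts (G \<restriction> X))"
      using inj by simp
    show "inj_on (iso_arcs \<lparr>iso_verts = f, iso_arcs = \<lambda>x. (f (tail G x), f (head G x)),
        iso_head = snd, iso_tail = fst\<rparr>) (arcs (G \<restriction> X))"
      using inj no_multi_arcs unfolding inj_on_def arc_to_ends_def by auto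
  qed auto
  moreover have "with_proj bull = app_iso hom (G \<restriction> X)"
  proof -
    have "iso_arcs hom ` arcs (G \<restriction> X) = (\<lambda>(u, v). (f u, f v)) ` (arcs_ends G \<inter> X \<times> X)"
      unfolding hom_def arcs_ends_conv by (auto simp: image_iff)
    also have "\<dots> = symcl {(0, 1), (1, 2), (2, 3), (4, 1), (4, 2)}"
      unfolding ends symcl_def by (auto simp: f)
    finally have "iso_arcs hom ` arcs (G \<restriction> X) = symcl {(0, 1), (1, 2), (2, 3), (4, 1), (4, 2)}" .
    moreover have "iso_verts hom ` verts (G \<restriction> X) = {0, 1, 2, 3, 4}"
      unfolding hom_def X_def using f by auto
    ultimately show ?thesis unfolding app_iso_def with_proj_def bull_def by (simp add: hom_def)
  qed
  ultimately have "digraph_iso (G \<restriction> X) (with_proj bull)" unfolding digraph_iso_def by blast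
  moreover have "induced_subgraph (G \<restriction> X) G" using V unfolding X_def by (rule induced_induce)
  ultimately show False using assms unfolding bull_free_def by blast
qed

end

section \<open>Rounding \<open>log 2 t\<close> up and comparing exponents\<close>

theorem theorem1p3:
  fixes t :: nat and G :: "('a, 'b) pre_digraph"
  assumes "t > 0" and "G \<in> \<B>\<^bsub>t\<^esub>"
  shows "real (chromatic_number G) \<le> real (clique_number G) powr (4 * log 2 (real t) + 13)"
proof -
  from assms(2) interpret graph G unfolding bull_free_class_def by simp
  have bf: "adj.no_bull (verts G)"
    using assms(2) no_bull_if_bull_free unfolding bull_free_class_def by simp
  have t: "adj.colourable T t" if "T \<subseteq> verts G" "adj.no_triangle T" for T
  proof (rule colourable_if_chromatic_number_le)
    show "finite T" using that(1) finite_verts by (rule finite_subset)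
    show "chromatic_number (G \<restriction> T) \<le> t"
      using assms(2) triangle_free_if_no_triangle[OF that(2)] induced_induce[OF that(1)]
      unfolding bull_free_class_def by blast
  qed
  \<comment> \<open>The maximum with \<open>1\<close> secures the factor two needed for split
    sets.\<close>
  define L where "L = max 1 (nat \<lceil>log 2 t\<rceil>)"
  define n where "n = clique_number G"
  have tL: "t \<le> 2 ^ L"
  proof -
    have "log 2 t \<le> real L" unfolding L_def by linarith
    then have "real t \<le> 2 powr real L" using assms(1) by (simp add: log_le_iff)
    then have "real t \<le> real (2 ^ L)" by (simp add: powr_realpow)
    then show ?thesis by (simp only: of_nat_le_iff)
  qed
  have "adj.colourable (verts G) (n ^ (2 * L + 15))"
    unfolding n_def clique_number_eq_omega
    by (rule adj.no_bull_colourable[OF finite_verts bf t tL]) (auto simp: L_def)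
  then have chi: "chromatic_number G \<le> n ^ (2 * L + 15)" by (rule chromatic_number_le)
  show ?thesis
  proof (cases "n \<le> 1")
    case True
    then have "n = 0 \<or> n = 1" by linarith
    then show ?thesis using chi unfolding n_def[symmetric] by (auto simp: power_0_left)
  next
    case False
    \<comment> \<open>For \<open>t = 1\<close> the exponents do not compare, but then there are no
      edges: the two ends of an edge span no triangle and need two colours.\<close>
    have "2 \<le> t"
    proof (rule ccontr)
      assume "\<not> 2 \<le> t"
      then have "t = 1" using assms(1) by simp
      obtain K where K: "K \<subseteq> verts G" "pairwise (\<lambda>u v. u \<rightarrow>\<^bsub>G\<^esub> v) K" "card K = n"
        using adj.omega_clique[OF finite_verts] unfolding n_def clique_number_eq_omega by blast
      then obtain x y where xy: "x \<in> K" "y \<in> K" "x \<noteq> y"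
        using card2_distinct[of K] False finite_subset[OF K(1) finite_verts] by auto
      have "adj.no_triangle {x, y}" unfolding adj.no_triangle_def using adj.irrefl by blast
      then have "adj.colourable {x, y} 1" using t[of "{x, y}"] \<open>t = 1\<close> xy K(1) by auto
      then show False
        using xy K(2) unfolding adj.colourable_def pairwise_def by fastforce
    qed
    \<comment> \<open>Equality holds at \<open>t = 2\<close>, where \<open>L = 1\<close>. For
      \<open>t = 3\<close> the claim rests on \<open>log 2 3 \<ge> 3 / 2\<close>, that is, on
      \<open>8 \<le> 9\<close>. From \<open>4\<close> on, \<open>L\<close> is at most
      \<open>log 2 t + 1\<close> and \<open>log 2 t\<close> is at least \<open>2\<close>.\<close>
    have "2 * real L + 15 \<le> 4 * log 2 (real t) + 13"
    proof -
      consider "t = 2" | "t = 3" | "4 \<le> t" using \<open>2 \<le> t\<close> by linarith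
      then show ?thesis
      proof cases
        case 1
        then show ?thesis unfolding L_def by simp
      next
        case 2
        have "log 2 3 \<le> (2::real)" by (simp add: log_le_iff)
        then have "L \<le> 2" using 2 unfolding L_def by (simp add: ceiling_le_iff)
        moreover have "3 \<le> 2 * log 2 (3::real)"
        proof -
          have "(3::real) = log 2 8" by (simp add: log_def ln_realpow[of 2 3, simplified])
          also have "\<dots> \<le> log 2 (3 ^ 2)" by simp
          also have "\<dots> = 2 * log 2 3" using log_nat_power[of 3 2 2] by simp
          finally show ?thesis .
        qed
        ultimately show ?thesis using 2 by simp
      next
        case 3
        then have "2 \<le> log 2 (real t)" by (simp add: le_log_iff)
        then show ?thesis unfolding L_def by linarith
      qed
    qed
    then have "real n powr (real (2 * L + 15)) \<le> real n powr (4 * log 2 (real t) + 13)"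
      using False by (intro powr_mono) auto
    moreover have "real (chromatic_number G) \<le> real n powr real (2 * L + 15)"
    proof -
      have "real (chromatic_number G) \<le> real (n ^ (2 * L + 15))" using chi by (rule of_nat_mono)
      also have "\<dots> = real n powr real (2 * L + 15)"
        using False by (subst powr_realpow) auto
      finally show ?thesis .
    qed
    ultimately show ?thesis unfolding n_def by linarith
  qed
qed

end
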